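(* The \textsc{$2$-tessellability} problem can be solved in linear time, i.e. in time $O(|V(G)|+|E(G)|)$ for an input graph $G$.
   Context: A tessellation of a graph $G$ is a partition of $V(G)$ into cliques; an edge belongs to it iff its endpoints lie in the same clique. A tessellation cover of $G$ is a set of tessellations such that every edge of $G$ belongs to at least one of them. $G$ is $2$-tessellable if it has a tessellation cover of size at most $2$; \textsc{$2$-tessellability} asks, given $G$, whether $G$ is $2$-tessellable. *)

theory Defs
  imports "HOL-Library.Disjoint_Sets"
begin

subsection \<open>Graphs and tessellations\<close>

definition simple_graph :: "'a set \<Rightarrow> 'a set set \<Rightarrow> bool" where
  "simple_graph V E \<longleftrightarrow> finite V \<and> (\<forall>e\<in>E. e \<subseteq> V \<and> card e = 2)"

text \<open>Cliques need not be maximal.\<close>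

definition clique :: "'a set \<Rightarrow> 'a set set \<Rightarrow> 'a set \<Rightarrow> bool" where
  "clique V E K \<longleftrightarrow> K \<subseteq> V \<and> (\<forall>u\<in>K. \<forall>v\<in>K. u \<noteq> v \<longrightarrow> {u, v} \<in> E)"

definition tessellation :: "'a set \<Rightarrow> 'a set set \<Rightarrow> 'a set set \<Rightarrow> bool" where
  "tessellation V E T \<longleftrightarrow> partition_on V T \<and> (\<forall>K\<in>T. clique V E K)"

definition edge_in_tessellation :: "'a set \<Rightarrow> 'a set set \<Rightarrow> bool" where
  "edge_in_tessellation e T \<longleftrightarrow> (\<exists>K\<in>T. e \<subseteq> K)"

definition tessellation_cover :: "'a set \<Rightarrow> 'a set set \<Rightarrow> 'a set set set \<Rightarrow> bool" where
  "tessellation_cover V E \<T> \<longleftrightarrow>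
     (\<forall>T\<in>\<T>. tessellation V E T) \<and> (\<forall>e\<in>E. \<exists>T\<in>\<T>. edge_in_tessellation e T)"

definition tessellable :: "nat \<Rightarrow> 'a set \<Rightarrow> 'a set set \<Rightarrow> bool" where
  "tessellable k V E \<longleftrightarrow> (\<exists>\<T>. tessellation_cover V E \<T> \<and> finite \<T> \<and> card \<T> \<le> k)"


subsection \<open>Random access machines\<close>

text \<open>
  A unit-cost RAM with finitely many registers (those named in the program) and an
  indirectly addressed memory. The only arithmetic is addition and truncated subtraction.
  Word size is not built into the machine; it is controlled by \<open>words_bounded\<close> below.
\<close>

datatype instr =
    Const nat nat       \<comment> \<open>\<open>r\<^sub>i := k\<close>\<close>
  | Move nat nat        \<comment> \<open>\<open>r\<^sub>i := r\<^sub>j\<close>\<close>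
  | Add nat nat nat     \<comment> \<open>\<open>r\<^sub>i := r\<^sub>j + r\<^sub>k\<close>\<close>
  | Sub nat nat nat     \<comment> \<open>\<open>r\<^sub>i := r\<^sub>j - r\<^sub>k\<close>, truncated at \<open>0\<close>\<close>
  | Load nat nat        \<comment> \<open>\<open>r\<^sub>i := mem[r\<^sub>j]\<close>\<close>
  | Store nat nat       \<comment> \<open>\<open>mem[r\<^sub>i] := r\<^sub>j\<close>\<close>
  | Jump nat            \<comment> \<open>continue at the given absolute position\<close>
  | JumpZero nat nat    \<comment> \<open>if \<open>r\<^sub>i = 0\<close> continue at the given absolute position\<close>

type_synonym program = "instr list"

record config =
  pc :: nat
  reg :: "nat \<Rightarrow> nat"
  mem :: "nat \<Rightarrow> nat"

fun exec_instr :: "instr \<Rightarrow> config \<Rightarrow> config" where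
  "exec_instr (Const i k) s = s\<lparr>pc := pc s + 1, reg := (reg s)(i := k)\<rparr>"
| "exec_instr (Move i j) s = s\<lparr>pc := pc s + 1, reg := (reg s)(i := reg s j)\<rparr>"
| "exec_instr (Add i j k) s = s\<lparr>pc := pc s + 1, reg := (reg s)(i := reg s j + reg s k)\<rparr>"
| "exec_instr (Sub i j k) s = s\<lparr>pc := pc s + 1, reg := (reg s)(i := reg s j - reg s k)\<rparr>"
| "exec_instr (Load i j) s = s\<lparr>pc := pc s + 1, reg := (reg s)(i := mem s (reg s j))\<rparr>"
| "exec_instr (Store i j) s = s\<lparr>pc := pc s + 1, mem := (mem s)(reg s i := reg s j)\<rparr>"
| "exec_instr (Jump l) s = s\<lparr>pc := l\<rparr>"
| "exec_instr (JumpZero i l) s = s\<lparr>pc := (if reg s i = 0 then l else pc s + 1)\<rparr>"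

text \<open>The machine halts by leaving the program.\<close>

definition halted :: "program \<Rightarrow> config \<Rightarrow> bool" where
  "halted P s \<longleftrightarrow> length P \<le> pc s"

definition step :: "program \<Rightarrow> config \<Rightarrow> config" where
  "step P s = (if halted P s then s else exec_instr (P ! pc s) s)"

definition initial_config :: "nat list \<Rightarrow> config" where
  "initial_config xs =
     \<lparr>pc = 0, reg = (\<lambda>_. 0), mem = (\<lambda>a. if a < length xs then xs ! a else 0)\<rparr>"

definition run :: "program \<Rightarrow> nat list \<Rightarrow> nat \<Rightarrow> config" where
  "run P xs t = (step P ^^ t) (initial_config xs)"

definition words_bounded :: "nat \<Rightarrow> config \<Rightarrow> bool" where
  "words_bounded B s \<longleftrightarrow> (\<forall>i. reg s i \<le> B) \<and> (\<forall>a. mem s a \<le> B)"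


subsection \<open>Linear time for graph problems\<close>

text \<open>
  The list \<open>vs\<close> numbers the vertices; \<open>al ! i\<close> lists, in any order, the numbers of the
  neighbours of the vertex with number \<open>i\<close>.
\<close>

definition adjacency_lists ::
  "'a set \<Rightarrow> 'a set set \<Rightarrow> 'a list \<Rightarrow> nat list list \<Rightarrow> bool" where
  "adjacency_lists V E vs al \<longleftrightarrow>
     distinct vs \<and> set vs = V \<and> length al = length vs \<and>
     (\<forall>i<length vs. distinct (al ! i) \<and>
        set (al ! i) = {j. j < length vs \<and> {vs ! i, vs ! j} \<in> E})"

text \<open>
  With \<open>n\<close> vertices, cell \<open>0\<close> holds \<open>n\<close>, and the list of vertex \<open>i\<close> occupies the cells
  from \<open>mem[1 + i]\<close> (inclusive) to \<open>mem[2 + i]\<close> (exclusive).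
\<close>

definition encode_adjacency_lists :: "nat list list \<Rightarrow> nat list" where
  "encode_adjacency_lists al =
     (let n = length al in
      n # map (\<lambda>i. n + 2 + length (concat (take i al))) [0..<n + 1] @ concat al)"

text \<open>
  Acceptance is \<open>1\<close> in register \<open>0\<close>, rejection is \<open>0\<close>. One program must serve all graphs
  and all their adjacency-list representations. All words occurring up to halting are
  polynomially bounded, so that the words have logarithmically many bits and unit cost is
  justified. The summand \<open>1\<close> matters only for the empty graph. Every finite graph is
  isomorphic to one with vertices in \<open>nat\<close>, and the machine sees only vertex numbers.
\<close>

definition solvable_in_linear_time :: "(nat set \<Rightarrow> nat set set \<Rightarrow> bool) \<Rightarrow> bool" where
  "solvable_in_linear_time Q \<longleftrightarrow>
     (\<exists>P c d. \<forall>V E vs al. simple_graph V E \<and> adjacency_lists V E vs al \<longrightarrow>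
        (\<exists>t \<le> c * (card V + card E + 1).
           let xs = encode_adjacency_lists al in
           halted P (run P xs t) \<and>
           reg (run P xs t) 0 = (if Q V E then 1 else 0) \<and>
           (\<forall>s\<le>t. words_bounded ((card V + card E + 2) ^ d) (run P xs s))))"

end

theory Submission
  imports Defs
begin

text \<open>
  A graph is 2-tessellable iff every vertex \<open>v\<close> can be given two labels \<open>t False v\<close>, \<open>t True v\<close> such
  that distinct vertices are adjacent iff they agree in one of them. Splitting classes that are
  contained in a class of the other side, one may assume that such classes are singletons. Then
  propagation is forced: if the class \<open>K\<close> of \<open>w\<close> on one side is known, its class on the other side is
  \<open>N[w] \<inter> N[x]\<close> for any neighbour \<open>x \<notin> K\<close> of \<open>w\<close>, and \<open>{w}\<close> if there is none. In a
  fresh component with root \<open>v\<close>, one class of \<open>v\<close> is \<open>N[v] \<inter> N[x]\<close>, where \<open>x\<close> is a neighbour with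
  \<open>N[v] \<not>\<subseteq> N[x]\<close> if there is one, and any neighbour otherwise.

  The machine computes labels in this way, breadth first, and then checks them by brute force: each
  label class must be a clique (every member has as many neighbours in the class as there are other
  members), and each edge must lie in a class. Hence only graphs with a labelling are accepted,
  and the propagation argument is needed only to see that every such graph is accepted. Whenever a
  vertex other than the current one is scanned, it is unlabelled on the side being filled
  and receives its label immediately afterwards, so each list is read a bounded number of times.
\<close>

subsection \<open>Two-sided labellings\<close>

text \<open>Why intersections of neighbourhoods are classes: if \<open>w\<close> and
  \<open>x\<close> agree on exactly one side, a common neighbour outside that class would have to
  agree with both on the other side, where they differ. For \<open>x \<notin> K\<close> this is
  immediate. For a root nothing is known about \<open>x\<close>, but a vertex of \<open>N[v]\<close>
  missed by \<open>N[x]\<close> excludes that \<open>v\<close> and \<open>x\<close> agree on both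
  sides. Why classes are split: if all neighbours of a vertex lie in \<open>K\<close>, its own edges
  allow any part of \<open>K\<close> as its second class; only a normal form makes this step forced.
  The obstacle to linear time is the choice of \<open>x\<close> at a root, since testing
  \<open>N[v] \<subseteq> N[u]\<close> reads the whole list of \<open>u\<close>. Every
  \<open>u\<close> that passes is adjacent to all the rest of \<open>N[v]\<close>, hence to the
  vertex finally chosen. So all tested vertices fall into the new class, and their labels pay for
  the tests. Time and word size come from one device, a program logic with credits: values grow only
  by increments, so a credit bound also bounds the words.\<close>

locale indexed_graph =
  fixes n :: nat and N :: "nat \<Rightarrow> nat set"
  assumes N_less: "v < n \<Longrightarrow> u \<in> N v \<Longrightarrow> u < n"
    and N_sym: "v < n \<Longrightarrow> u \<in> N v \<Longrightarrow> v \<in> N u"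
    and N_irrefl: "v < n \<Longrightarrow> v \<notin> N v"
begin

definition labelling :: "(bool \<Rightarrow> nat \<Rightarrow> nat) \<Rightarrow> bool" where
  "labelling t \<longleftrightarrow> (\<forall>u<n. \<forall>v<n. u \<noteq> v \<longrightarrow> (u \<in> N v \<longleftrightarrow> (\<exists>s. t s u = t s v)))"

lemma ex_side: "(\<exists>s'. P s') \<longleftrightarrow> P s \<or> P (\<not> s)"
  by (cases s) (auto simp: ex_bool_eq)

lemma labelling_adj:
  assumes "labelling t" "u < n" "v < n" "u \<noteq> v"
  shows "u \<in> N v \<longleftrightarrow> t s u = t s v \<or> t (\<not> s) u = t (\<not> s) v"
  using assms ex_side[of "\<lambda>s. t s u = t s v" s] unfolding labelling_def by blast

lemma labelling_edge:
  "labelling t \<Longrightarrow> v < n \<Longrightarrow> u \<in> N v \<Longrightarrow> \<exists>s. t s u = t s v"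
  using N_less N_irrefl unfolding labelling_def by metis

section \<open>Normal form: contained classes are singletons\<close>

text \<open>This makes the second class of a vertex unique: when all neighbours of a vertex lie in
  one of its classes, the other class is contained in that one, and only the singleton is
  left.\<close>

definition reduced :: "(bool \<Rightarrow> nat \<Rightarrow> nat) \<Rightarrow> bool" where
  "reduced t \<longleftrightarrow> (\<forall>s. \<forall>u<n. \<forall>v<n.
     (\<forall>w<n. t s w = t s v \<longrightarrow> t (\<not> s) w = t (\<not> s) v) \<longrightarrow> t s u = t s v \<longrightarrow> u = v)"

text \<open>Every class contained in a class of the other side is split into singletons; the parity keeps
  the new labels apart from the old ones.\<close>

definition split_side :: "bool \<Rightarrow> (bool \<Rightarrow> nat \<Rightarrow> nat) \<Rightarrow> bool \<Rightarrow> nat \<Rightarrow> nat" where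
  "split_side s t = t(s := \<lambda>v. if \<forall>w<n. t s w = t s v \<longrightarrow> t (\<not> s) w = t (\<not> s) v
     then 2 * v + 1 else 2 * t s v)"

text \<open>The containment test has the same outcome for all members of a class, so a class is
  either kept or split completely. In the mixed case the parities differ.\<close>

lemma split_side_eq:
  assumes "u < n" "v < n" "u \<noteq> v"
  shows "split_side s t s u = split_side s t s v \<longleftrightarrow>
    t s u = t s v \<and> \<not> (\<forall>w<n. t s w = t s v \<longrightarrow> t (\<not> s) w = t (\<not> s) v)"
proof -
  define c where "c v \<longleftrightarrow> (\<forall>w<n. t s w = t s v \<longrightarrow> t (\<not> s) w = t (\<not> s) v)" for v
  have odd: "2 * a + 1 \<noteq> 2 * (b :: nat)" "2 * b \<noteq> 2 * a + 1" for a b by presburger+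
  have c: "c u \<longleftrightarrow> c v" if "t s u = t s v"
    unfolding c_def using assms that by metis
  have e: "split_side s t s w = (if c w then 2 * w + 1 else 2 * t s w)" for w
    by (simp add: split_side_def c_def)
  show ?thesis
    unfolding e c_def[symmetric] using c odd assms(3) by (cases "c u"; cases "c v") auto
qed

lemma split_side_other: "split_side s t (\<not> s) = t (\<not> s)"
  by (simp add: split_side_def)

text \<open>Two vertices separated by the split still agree on the other side, because their common
  class was contained in a class there. So no adjacency loses its witness.\<close>

lemma labelling_split_side:
  assumes "labelling t"
  shows "labelling (split_side s t)"
  unfolding labelling_def
proof (intro allI impI)
  fix u v assume uv: "u < n" "v < n" "u \<noteq> v"
  have "(\<exists>s'. split_side s t s' u = split_side s t s' v) \<longleftrightarrow> (\<exists>s'. t s' u = t s' v)"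
    using split_side_eq[OF uv, of s t] uv unfolding ex_side[where s = s] split_side_other by blast
  then show "u \<in> N v \<longleftrightarrow> (\<exists>s'. split_side s t s' u = split_side s t s' v)"
    using assms uv unfolding labelling_def by blast
qed

text \<open>Splitting side \<open>True\<close> last does not spoil side \<open>False\<close>: it
  only refines the \<open>True\<close> classes, so no \<open>False\<close> class becomes contained
  in one that did not contain it before.\<close>

lemma ex_reduced_labelling:
  assumes "labelling t"
  obtains t' where "labelling t'" "reduced t'"
proof
  let ?a = "split_side False t" and ?b = "split_side True (split_side False t)"
  show "labelling ?b" using assms by (intro labelling_split_side)
  have b: "?b True u = ?b True v \<longleftrightarrow>
      ?a True u = ?a True v \<and> \<not> (\<forall>w<n. ?a True w = ?a True v \<longrightarrow> ?a False w = ?a False v)"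
    if "u < n" "v < n" "u \<noteq> v" for u v
    using split_side_eq[OF that, of True ?a] by simp
  have a: "?a False u = ?a False v \<longleftrightarrow>
      t False u = t False v \<and> \<not> (\<forall>w<n. t False w = t False v \<longrightarrow> t True w = t True v)"
    if "u < n" "v < n" "u \<noteq> v" for u v
    using split_side_eq[OF that, of False t] by simp
  have ba: "?b False = ?a False" "?a True = t True"
    using split_side_other[of True ?a] split_side_other[of False t] by simp_all
  have r1: "u = v" if "u < n" "v < n" "\<forall>w<n. ?b True w = ?b True v \<longrightarrow> ?b False w = ?b False v"
    "?b True u = ?b True v" for u v
    using that b ba by metis
  have r2: "u = v" if "u < n" "v < n" "\<forall>w<n. ?b False w = ?b False v \<longrightarrow> ?b True w = ?b True v"
    "?b False u = ?b False v" for u v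
  proof (rule ccontr)
    assume "u \<noteq> v"
    with that a ba obtain w where "w < n" "t False w = t False v" "t True w \<noteq> t True v" by metis
    moreover from this have "?a False w = ?a False v"
      using a[of w v] that by metis
    ultimately show False using that b ba by metis
  qed
  show "reduced ?b" unfolding reduced_def
  proof (intro allI impI)
    fix s u v
    assume h: "u < n" "v < n" "\<forall>w<n. ?b s w = ?b s v \<longrightarrow> ?b (\<not> s) w = ?b (\<not> s) v"
      "?b s u = ?b s v"
    show "u = v"
    proof (cases "s = True")
      case True
      show ?thesis using r1[OF h(1,2)] h(3,4) unfolding True simp_thms by blast
    next
      case False
      then have s: "s = False" by simp
      show ?thesis using r2[OF h(1,2)] h(3,4) unfolding s simp_thms by blast
    qed
  qed
qed

text \<open>The label \<open>0\<close> means unlabelled.\<close>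

definition agrees :: "(bool \<Rightarrow> nat \<Rightarrow> nat) \<Rightarrow> (bool \<Rightarrow> nat \<Rightarrow> nat) \<Rightarrow> bool" where
  "agrees t L \<longleftrightarrow> (\<forall>s. \<forall>y<n. L s y \<noteq> 0 \<longrightarrow> (\<forall>z<n. L s z = L s y \<longleftrightarrow> t s z = t s y))"

definition feasible :: "(bool \<Rightarrow> nat \<Rightarrow> nat) \<Rightarrow> bool" where
  "feasible L \<longleftrightarrow> (\<exists>t. labelling t \<and> reduced t \<and> agrees t L)"

section \<open>Extending a partial labelling by one class\<close>

text \<open>The intended set is \<open>N[w] \<inter> N[x]\<close>, written as the program collects
  it; the choice \<open>x = w\<close> encodes the singleton class.\<close>

definition new_class :: "(bool \<Rightarrow> nat \<Rightarrow> nat) \<Rightarrow> bool \<Rightarrow> nat \<Rightarrow> nat \<Rightarrow> nat set" where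
  "new_class L s w x =
     insert w (if x = w then {} else insert x {y \<in> N x. (y = w \<or> y \<in> N w) \<and> L s y = 0})"

definition relabel :: "(bool \<Rightarrow> nat \<Rightarrow> nat) \<Rightarrow> bool \<Rightarrow> nat \<Rightarrow> nat \<Rightarrow> bool \<Rightarrow> nat \<Rightarrow> nat" where
  "relabel L s w x = L(s := \<lambda>y. if y \<in> new_class L s w x then Suc w else L s y)"

definition fresh :: "(bool \<Rightarrow> nat \<Rightarrow> nat) \<Rightarrow> bool" where
  "fresh L \<longleftrightarrow> (\<forall>s. \<forall>w<n. L s w = 0 \<longrightarrow> (\<forall>y<n. L s y \<noteq> Suc w))"

text \<open>As \<open>w\<close> is unlabelled, \<open>agrees\<close> forces its whole witness class
  to be unlabelled. So the new class overwrites no old label, and \<open>fresh\<close> keeps its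
  label apart from the others.\<close>

lemma agrees_relabel:
  assumes "agrees t L" "fresh L" "w < n" "L s w = 0"
    and "\<And>y. y < n \<Longrightarrow> y \<in> new_class L s w x \<longleftrightarrow> t s y = t s w"
  shows "agrees t (relabel L s w x)"
  unfolding agrees_def
proof (intro allI impI)
  fix s' y z assume y: "y < n" "relabel L s w x s' y \<noteq> 0" and z: "z < n"
  show "relabel L s w x s' z = relabel L s w x s' y \<longleftrightarrow> t s' z = t s' y"
  proof (cases "s' = s")
    case False
    then show ?thesis using assms(1) y z by (auto simp: relabel_def agrees_def)
  next
    case True
    have "L s u \<noteq> Suc w" if "u < n" for u using assms that by (auto simp: fresh_def)
    moreover have "t s z \<noteq> t s w" if "L s z \<noteq> 0" using assms(1,3,4) z that
      by (metis agrees_def)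
    ultimately show ?thesis using True assms y z
      by (auto simp: relabel_def agrees_def) metis+
  qed
qed

lemma fresh_relabel:
  assumes "fresh L" "w < n" "L s w = 0"
  shows "fresh (relabel L s w x)"
  using assms by (auto simp: fresh_def relabel_def new_class_def)

text \<open>The witness \<open>t\<close> itself survives. If \<open>x\<close> and \<open>w\<close>
  differ on the other side, their edge is witnessed on \<open>s\<close>, and so is every common
  neighbour. If there is no such \<open>x\<close>, the class of \<open>w\<close> on \<open>s\<close>
  is contained in its class on the other side, and \<open>reduced\<close> makes it a
  singleton.\<close>

lemma feasible_propagate:
  assumes "feasible L" "fresh L" "w < n" "L s w = 0" "L (\<not> s) w \<noteq> 0"
    and "if x = w then \<forall>u\<in>N w. L s u \<noteq> 0 \<or> L (\<not> s) u = L (\<not> s) w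
         else x \<in> N w \<and> L s x = 0 \<and> L (\<not> s) x \<noteq> L (\<not> s) w"
  shows "feasible (relabel L s w x)"
proof -
  from assms(1) obtain t where t: "labelling t" "reduced t" "agrees t L"
    by (auto simp: feasible_def)
  have adj: "u \<in> N v \<longleftrightarrow> t s u = t s v \<or> t (\<not> s) u = t (\<not> s) v" if "u < n" "v < n" "u \<noteq> v" for u v
    using labelling_adj[OF t(1) that] .
  have unl: "L s y = 0" if "y < n" "t s y = t s w" for y
    using t(3) that assms(3,4) by (metis agrees_def)
  have oth: "L (\<not> s) y = L (\<not> s) w \<longleftrightarrow> t (\<not> s) y = t (\<not> s) w" if "y < n" for y
    using t(3) that assms(3,5) by (metis agrees_def)
  have "y \<in> new_class L s w x \<longleftrightarrow> t s y = t s w" if y: "y < n" for y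
  proof (cases "x = w")
    case True
    \<comment> \<open>Members of the witness class of \<open>w\<close> are unlabelled on
      \<open>s\<close>, so for them only the second alternative of the hypothesis remains.\<close>
    have "\<forall>u<n. t s u = t s w \<longrightarrow> t (\<not> s) u = t (\<not> s) w"
      using True assms(3,6) adj unl oth by metis
    then have "t s y = t s w \<longleftrightarrow> y = w"
      using t(2) y assms(3) unfolding reduced_def by blast
    then show ?thesis using True by (simp add: new_class_def)
  next
    case False
    then have x: "x \<in> N w" "L s x = 0" "L (\<not> s) x \<noteq> L (\<not> s) w" using assms(6) by auto
    have xn: "x < n" using x assms(3) N_less by blast
    have tx: "t (\<not> s) x \<noteq> t (\<not> s) w" using oth[OF xn] x by simp
    have "t s x = t s w" using adj[OF xn assms(3) False] x tx by blast
    moreover have "y \<in> N x \<Longrightarrow> y \<noteq> x" "y \<in> N w \<Longrightarrow> y \<noteq> w"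
      using N_irrefl xn assms(3) by blast+
    ultimately show ?thesis
      using adj[OF y xn] adj[OF y assms(3)] unl[OF y] tx False \<open>y \<in> N x \<Longrightarrow> y \<noteq> x\<close> \<open>y \<in> N w \<Longrightarrow> y \<noteq> w\<close>
      unfolding new_class_def by auto
  qed
  from agrees_relabel[OF t(3) assms(2-4) this] t show ?thesis
    by (auto simp: feasible_def)
qed

definition saturated :: "(bool \<Rightarrow> nat \<Rightarrow> nat) \<Rightarrow> bool" where
  "saturated L \<longleftrightarrow> (\<forall>y<n. L False y = 0 \<longleftrightarrow> L True y = 0)"

text \<open>The unlabelled vertices form a union of components, so the two sides of the witness may be
  interchanged on them.\<close>

lemma feasible_swap:
  assumes "labelling t" "reduced t" "agrees t L" "saturated L"
  obtains t' where "labelling t'" "reduced t'" "agrees t' L"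
    "\<And>s u v. u < n \<Longrightarrow> v < n \<Longrightarrow> L False u = 0 \<Longrightarrow> L False v = 0 \<Longrightarrow>
       t' s u = t' s v \<longleftrightarrow> t (\<not> s) u = t (\<not> s) v"
proof
  \<comment> \<open>Odd values on the unlabelled vertices keep the exchanged labels apart from the
    even ones elsewhere.\<close>
  define t' where "t' s y = (if L False y = 0 then 2 * t (\<not> s) y + 1 else 2 * t s y)" for s y
  have L: "L s y = 0 \<longleftrightarrow> L False y = 0" if "y < n" for s y
    using assms(4) that by (cases s) (auto simp: saturated_def)
  have odd: "2 * a + 1 \<noteq> 2 * (b :: nat)" "2 * b \<noteq> 2 * a + 1" for a b by presburger+
  have sep: "t s u \<noteq> t s v" if "u < n" "v < n" "L False u = 0" "L False v \<noteq> 0" for s u v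
    using assms(3) L that by (metis agrees_def)
  have e: "t' s u = t' s v \<longleftrightarrow> (if L False u = 0 then L False v = 0 \<and> t (\<not> s) u = t (\<not> s) v
      else L False v \<noteq> 0 \<and> t s u = t s v)" for s u v
    using odd by (auto simp: t'_def)
  have e2: "(\<exists>s. t' s u = t' s v) \<longleftrightarrow> (\<exists>s. t s u = t s v)" if "u < n" "v < n" for u v
    using sep[of u v] sep[of v u] that unfolding e by (smt (verit, ccfv_SIG))
  show "labelling t'"
    using assms(1) e2 unfolding labelling_def by blast
  show "agrees t' L"
    using assms(3) L sep unfolding agrees_def e by metis
  show "t' s u = t' s v \<longleftrightarrow> t (\<not> s) u = t (\<not> s) v"
    if "u < n" "v < n" "L False u = 0" "L False v = 0" for s u v
    using that e by simp
  show "reduced t'" unfolding reduced_def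
  proof (intro allI impI)
    fix s u v
    assume uv: "u < n" "v < n" "t' s u = t' s v"
      and sub: "\<forall>w<n. t' s w = t' s v \<longrightarrow> t' (\<not> s) w = t' (\<not> s) v"
    show "u = v"
    proof (cases "L False v = 0")
      case True
      then have "\<forall>w<n. t (\<not> s) w = t (\<not> s) v \<longrightarrow> t (\<not> \<not> s) w = t (\<not> \<not> s) v"
        using sub sep uv unfolding e by metis
      moreover have "t (\<not> s) u = t (\<not> s) v" using uv True e by metis
      ultimately show ?thesis using assms(2) uv(1,2) unfolding reduced_def by blast
    next
      case False
      then have "\<forall>w<n. t s w = t s v \<longrightarrow> t (\<not> s) w = t (\<not> s) v"
        using sub sep uv unfolding e by metis
      moreover have "t s u = t s v" using uv False e by metis
      ultimately show ?thesis using assms(2) uv(1,2) unfolding reduced_def by blast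
    qed
  qed
qed

text \<open>The choice made here loses nothing: in every witness the computed set is a class of
  \<open>v\<close> on one of the two sides, and on unlabelled components the sides may be
  exchanged.\<close>

lemma feasible_seed:
  assumes "feasible L" "fresh L" "saturated L" "v < n" "L False v = 0"
    and "if x = v then \<forall>u\<in>N v. L False u \<noteq> 0
         else x \<in> N v \<and> (insert v (N v) \<subseteq> insert x (N x) \<longrightarrow> 
           (\<forall>u\<in>N v. L False u = 0 \<longrightarrow> insert v (N v) \<subseteq> insert u (N u)))"
  shows "feasible (relabel L False v x)"
proof -
  from assms(1) obtain t0 where t0: "labelling t0" "reduced t0" "agrees t0 L"
    by (auto simp: feasible_def)
  have adj0: "u \<in> N w \<longleftrightarrow> t0 False u = t0 False w \<or> t0 True u = t0 True w" if "u < n" "w < n" "u \<noteq> w" for u w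
    using labelling_adj[OF t0(1) that, of False] by simp
  \<comment> \<open>A neighbour shares a class with \<open>v\<close> on some side, where
    \<open>v\<close> is unlabelled too; saturation carries this over to side
    \<open>False\<close>.\<close>
  have unl: "L False u = 0" if uv: "u \<in> N v" for u
  proof -
    have u: "u < n" "u \<noteq> v" using uv assms(4) N_less N_irrefl by blast+
    then obtain s where "t0 s u = t0 s v"
      using labelling_edge[OF t0(1) assms(4) uv] by blast
    moreover have "L s v = 0" using assms(3-5) by (cases s) (auto simp: saturated_def)
    ultimately have "L s u = 0" using t0(3) u assms(4) by (metis agrees_def)
    then show ?thesis using assms(3) u by (cases s) (auto simp: saturated_def)
  qed
  have x_cond: "if x = v then N v = {}
     else x \<in> N v \<and> (insert v (N v) \<subseteq> insert x (N x) \<longrightarrow> (\<forall>u\<in>N v. insert v (N v) \<subseteq> insert u (N u)))"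
    using assms(6) unl by (auto split: if_splits)
  define good where "good t \<longleftrightarrow> (\<forall>y<n. y \<in> insert v (N v) \<inter> insert x (N x) \<longleftrightarrow> t False y = t False v)"
    for t :: "bool \<Rightarrow> nat \<Rightarrow> nat"
  have goodI: "\<exists>s. \<forall>y<n. y \<in> insert v (N v) \<inter> insert x (N x) \<longleftrightarrow> t0 s y = t0 s v"
  proof (cases "x = v")
    case True
    then show ?thesis using assms(4) x_cond adj0 by (metis Int_iff empty_iff insert_iff)
  next
    case False
    then have x: "x \<in> N v" "x < n" using assms(4) x_cond N_less by auto
    show ?thesis
    proof (cases "insert v (N v) \<subseteq> insert x (N x)")
      case False
      then obtain z where z: "z \<in> N v" "z \<notin> N x" "z \<noteq> x"
        using N_sym[OF assms(4) x(1)] by blast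
      have zn: "z < n" using z N_less assms(4) by blast
      obtain s where s: "t0 s x = t0 s v"
        using labelling_edge[OF t0(1) assms(4) x(1)] by blast
      have adj: "u \<in> N w \<longleftrightarrow> t0 s u = t0 s w \<or> t0 (\<not> s) u = t0 (\<not> s) w" if "u < n" "w < n" "u \<noteq> w" for u w
        using labelling_adj[OF t0(1) that] .
      \<comment> \<open>If \<open>x\<close> and \<open>v\<close> agreed on both sides, then
        \<open>z\<close>, which shares a class with \<open>v\<close>, would share it with
        \<open>x\<close>.\<close>
      have "t0 (\<not> s) x \<noteq> t0 (\<not> s) v"
        using s z zn adj[OF zn x(2)] adj[OF zn assms(4)] N_irrefl[OF assms(4)] by metis
      then have "\<forall>y<n. y \<in> insert v (N v) \<inter> insert x (N x) \<longleftrightarrow> t0 s y = t0 s v"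
        using s adj assms(4) x(2) by (metis Int_iff insert_iff)
      then show ?thesis by blast
    next
      case True
      then have all: "insert v (N v) \<subseteq> insert u (N u)" if "u \<in> N v" for u
        using x_cond \<open>x \<noteq> v\<close> that by simp
      \<comment> \<open>Otherwise each class of \<open>v\<close> has a member outside the other. Two
        such members share no class, yet domination makes them adjacent. So one class of
        \<open>v\<close> contains the other and is all of \<open>N[v]\<close>.\<close>
      have "\<exists>s. \<forall>y<n. t0 (\<not> s) y = t0 (\<not> s) v \<longrightarrow> t0 s y = t0 s v"
      proof (rule ccontr)
        assume "\<not> ?thesis"
        then obtain y z where yz: "y < n" "t0 True y = t0 True v" "t0 False y \<noteq> t0 False v"
          "z < n" "t0 False z = t0 False v" "t0 True z \<noteq> t0 True v"
          by (metis (full_types))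
        then have "y \<in> N v" "z \<in> N v" "y \<noteq> z" using adj0 assms(4) by metis+
        then have "y \<in> N z" using all by blast
        then show False using yz adj0 \<open>y \<noteq> z\<close> by metis
      qed
      then obtain s where "\<forall>y<n. t0 (\<not> s) y = t0 (\<not> s) v \<longrightarrow> t0 s y = t0 s v" by blast
      moreover have "y \<in> N v \<longleftrightarrow> t0 s y = t0 s v \<or> t0 (\<not> s) y = t0 (\<not> s) v" if "y < n" "y \<noteq> v" for y
        using labelling_adj[OF t0(1) that(1) assms(4) that(2)] .
      ultimately have "\<forall>y<n. y \<in> insert v (N v) \<longleftrightarrow> t0 s y = t0 s v" by (metis insert_iff)
      moreover have "insert v (N v) \<inter> insert x (N x) = insert v (N v)" using True by blast
      ultimately show ?thesis by auto
    qed
  qed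
  \<comment> \<open>The program always stores the first class on side \<open>False\<close>; if the
    witness has it on side \<open>True\<close>, the exchanged witness is used.\<close>
  obtain t where t: "labelling t" "reduced t" "agrees t L" "good t"
  proof -
    from goodI obtain s where s: "\<forall>y<n. y \<in> insert v (N v) \<inter> insert x (N x) \<longleftrightarrow> t0 s y = t0 s v" by blast
    show thesis
    proof (cases s)
      case False
      then show ?thesis using that[of t0] t0 s by (simp add: good_def)
    next
      case True
      obtain t' where t': "labelling t'" "reduced t'" "agrees t' L"
        "\<And>s u v. u < n \<Longrightarrow> v < n \<Longrightarrow> L False u = 0 \<Longrightarrow> L False v = 0 \<Longrightarrow>
           t' s u = t' s v \<longleftrightarrow> t0 (\<not> s) u = t0 (\<not> s) v"
        using feasible_swap[OF t0 assms(3)] by blast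
      have "good t'" unfolding good_def
      proof (intro allI impI)
        fix y assume y: "y < n"
        show "y \<in> insert v (N v) \<inter> insert x (N x) \<longleftrightarrow> t' False y = t' False v"
        proof (cases "L False y = 0")
          case True
          then show ?thesis using t'(4)[OF y assms(4) _ assms(5), of False] s y \<open>s\<close> by simp
        next
          case False
          then have "y \<noteq> v" "y \<notin> N v" using unl assms(5) by auto
          moreover have "t' False y \<noteq> t' False v"
            using t'(3) False assms(4,5) y by (metis agrees_def)
          ultimately show ?thesis by blast
        qed
      qed
      then show ?thesis using that t' by blast
    qed
  qed
  have "y \<in> new_class L False v x \<longleftrightarrow> t False y = t False v" if y: "y < n" for y
  proof -
    have "y \<in> new_class L False v x \<longleftrightarrow> y \<in> insert v (N v) \<inter> insert x (N x)"
    proof (cases "x = v")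
      case True
      then show ?thesis using x_cond by (simp add: new_class_def)
    next
      case False
      then have x: "x \<in> N v" using x_cond by auto
      then have "v \<in> N x" using N_sym assms(4) by blast
      then show ?thesis using False x unl assms(5) by (auto simp: new_class_def)
    qed
    with t(4) y show ?thesis by (simp add: good_def)
  qed
  from agrees_relabel[OF t(3) assms(2,4,5) this] t show ?thesis
    by (auto simp: feasible_def)
qed

section \<open>Checking complete labels by counting\<close>

definition verified :: "(bool \<Rightarrow> nat \<Rightarrow> nat) \<Rightarrow> bool" where
  "verified L \<longleftrightarrow>
     (\<forall>s. \<forall>v<n. Suc (card {y \<in> N v. L s y = L s v}) = card {y. y < n \<and> L s y = L s v}) \<and>
     (\<forall>v<n. \<forall>y\<in>N v. \<exists>s. L s y = L s v)"

text \<open>Counting replaces the comparison of pairs: \<open>v\<close> and its neighbours in the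
  class form a subset of the finite class, and equal cardinality forces equality.\<close>

lemma verified_imp_labelling:
  assumes "verified L"
  shows "labelling L"
  unfolding labelling_def
proof (intro allI impI iffI)
  fix u v assume "u < n" "v < n" "u \<noteq> v" "u \<in> N v"
  then show "\<exists>s. L s u = L s v" using assms by (auto simp: verified_def)
next
  fix u v assume uv: "u < n" "v < n" "u \<noteq> v" "\<exists>s. L s u = L s v"
  then obtain s where s: "L s u = L s v" by blast
  let ?K = "{y \<in> N v. L s y = L s v}" and ?C = "{y. y < n \<and> L s y = L s v}"
  have "finite ?K" by (rule finite_subset[of _ "{..<n}"]) (use N_less uv in auto)
  then have "card (insert v ?K) = card ?C"
    using assms uv N_irrefl by (auto simp: verified_def)
  moreover have "insert v ?K \<subseteq> ?C" using N_less uv by auto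
  ultimately have "insert v ?K = ?C"
    by (intro card_subset_eq) auto
  then show "u \<in> N v" using s uv by auto
qed

lemma labelling_imp_verified:
  assumes "labelling L"
  shows "verified L"
  unfolding verified_def
proof (intro conjI allI impI ballI)
  fix s v assume v: "v < n"
  have fin: "finite {y \<in> N v. L s y = L s v}"
    by (rule finite_subset[of _ "{..<n}"]) (use N_less v in auto)
  have "{y. y < n \<and> L s y = L s v} = insert v {y \<in> N v. L s y = L s v}"
    using labelling_adj[OF assms _ v, of _ s] v N_less[OF v] by blast
  then show "Suc (card {y \<in> N v. L s y = L s v}) = card {y. y < n \<and> L s y = L s v}"
    using fin v N_irrefl by simp
next
  fix v y assume "v < n" "y \<in> N v"
  then show "\<exists>s. L s y = L s v"
    using labelling_edge[OF assms] by blast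
qed

text \<open>When everything is labelled, \<open>agrees\<close> says that \<open>L\<close> and the
  witness induce the same classes, so \<open>L\<close> is itself a labelling. In the other direction
  a verified \<open>L\<close> is the required labelling, however it was computed.\<close>

lemma verified_iff:
  assumes "(\<exists>t. labelling t) \<longrightarrow> feasible L" "\<And>s y. y < n \<Longrightarrow> L s y \<noteq> 0"
  shows "verified L \<longleftrightarrow> (\<exists>t. labelling t)"
proof
  assume "\<exists>t. labelling t"
  then obtain t where t: "labelling t" "agrees t L" using assms(1) by (auto simp: feasible_def)
  have "L s z = L s y \<longleftrightarrow> t s z = t s y" if "y < n" "z < n" for s y z
    using t(2) assms(2) that by (auto simp: agrees_def)
  then have "labelling L" using t(1) by (simp add: labelling_def)
  then show "verified L" by (rule labelling_imp_verified)
qed (use verified_imp_labelling in blast)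

lemma feasible_initial:
  assumes "labelling t" "\<And>s y. L s y = 0"
  shows "feasible L"
  using ex_reduced_labelling[OF assms(1)] assms(2) unfolding feasible_def agrees_def by metis

end


subsection \<open>A structured language compiled to the machine\<close>

datatype com =
    Skip
  | Zero nat
  | Inc nat nat
  | Copy nat nat
  | Input nat nat
  | Get nat nat nat
  | Put nat nat nat
  | Seq com com (infixr ";;" 60)
  | IfNeq nat nat com com
  | WhileNeq nat nat com

text \<open>
  A configuration consists of the scalar variables \<open>r\<close>, the arrays \<open>A j\<close>, and the number \<open>k\<close> of
  credits; every elementary step costs one credit. Since \<open>Inc\<close> is the only arithmetic, the sum of
  any stored value and \<open>k\<close> never grows, which bounds all words.
\<close>

inductive big :: "nat list \<Rightarrow> com \<Rightarrow> (nat \<Rightarrow> nat) \<Rightarrow> (nat \<Rightarrow> nat \<Rightarrow> nat) \<Rightarrow> nat \<Rightarrow>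
    (nat \<Rightarrow> nat) \<Rightarrow> (nat \<Rightarrow> nat \<Rightarrow> nat) \<Rightarrow> nat \<Rightarrow> bool" for xs where
  Skip: "big xs Skip r A k r A k"
| Zero: "big xs (Zero x) r A (Suc k) (r(x := 0)) A k"
| Inc: "big xs (Inc x y) r A (Suc k) (r(x := Suc (r y))) A k"
| Copy: "big xs (Copy x y) r A (Suc k) (r(x := r y)) A k"
| Input: "r y < length xs \<Longrightarrow> big xs (Input x y) r A (Suc k) (r(x := xs ! r y)) A k"
| Get: "big xs (Get x j y) r A (Suc k) (r(x := A j (r y))) A k"
| Put: "big xs (Put j y x) r A (Suc k) r (A(j := (A j)(r y := r x))) k"
| Seq: "big xs c r A k r' A' k' \<Longrightarrow> big xs d r' A' k' r'' A'' k'' \<Longrightarrow> big xs (c ;; d) r A k r'' A'' k''"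
| IfNeq: "r x \<noteq> r y \<Longrightarrow> big xs c r A k r' A' k' \<Longrightarrow> big xs (IfNeq x y c d) r A (Suc k) r' A' k'"
| IfEq: "r x = r y \<Longrightarrow> big xs d r A k r' A' k' \<Longrightarrow> big xs (IfNeq x y c d) r A (Suc k) r' A' k'"
| WhileNeq: "r x \<noteq> r y \<Longrightarrow> big xs c r A k r' A' k' \<Longrightarrow> big xs (WhileNeq x y c) r' A' k' r'' A'' k'' \<Longrightarrow>
     big xs (WhileNeq x y c) r A (Suc k) r'' A'' k''"
| WhileEq: "r x = r y \<Longrightarrow> big xs (WhileNeq x y c) r A (Suc k) r A k"

fun well_formed :: "com \<Rightarrow> bool" where
  "well_formed Skip \<longleftrightarrow> True"
| "well_formed (Zero x) \<longleftrightarrow> x < 20"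
| "well_formed (Inc x y) \<longleftrightarrow> x < 20 \<and> y < 20"
| "well_formed (Copy x y) \<longleftrightarrow> x < 20 \<and> y < 20"
| "well_formed (Input x y) \<longleftrightarrow> x < 20 \<and> y < 20"
| "well_formed (Get x j y) \<longleftrightarrow> x < 20 \<and> j < 8 \<and> y < 20"
| "well_formed (Put j y x) \<longleftrightarrow> x < 20 \<and> j < 8 \<and> y < 20"
| "well_formed (c ;; d) \<longleftrightarrow> well_formed c \<and> well_formed d"
| "well_formed (IfNeq x y c d) \<longleftrightarrow> x < 20 \<and> y < 20 \<and> well_formed c \<and> well_formed d"
| "well_formed (WhileNeq x y c) \<longleftrightarrow> x < 20 \<and> y < 20 \<and> well_formed c"

text \<open>
  The input stays in place and the arrays \<open>A 0, \<dots>, A 7\<close> are interleaved behind it, so no array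
  sizes have to be known. Registers 20 and 21 are scratch; register 22 holds the length of the input.
\<close>

definition address_code :: "nat \<Rightarrow> nat \<Rightarrow> instr list" where
  "address_code j y =
     [Add 20 y y, Add 20 20 20, Add 20 20 20, Add 20 20 22, Const 21 j, Add 20 20 21]"

text \<open>As subtraction truncates, the sum of the two differences vanishes exactly for equal
  values.\<close>

definition difference_code :: "nat \<Rightarrow> nat \<Rightarrow> instr list" where
  "difference_code x y = [Sub 20 x y, Sub 21 y x, Add 20 20 21]"

fun code_length :: "com \<Rightarrow> nat" where
  "code_length Skip = 0"
| "code_length (Zero x) = 1"
| "code_length (Inc x y) = 2"
| "code_length (Copy x y) = 1"
| "code_length (Input x y) = 1"
| "code_length (Get x j y) = 7"
| "code_length (Put j y x) = 7"
| "code_length (c ;; d) = code_length c + code_length d"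
| "code_length (IfNeq x y c d) = code_length c + code_length d + 5"
| "code_length (WhileNeq x y c) = code_length c + 5"

text \<open>Jumps are absolute, hence the parameter for the position of the code. The offset 4 skips
  the test, three instructions and the conditional jump; the offset 5 also skips the jump closing
  the first branch or the loop.\<close>

fun compile :: "nat \<Rightarrow> com \<Rightarrow> instr list" where
  "compile l Skip = []"
| "compile l (Zero x) = [Const x 0]"
| "compile l (Inc x y) = [Const 20 1, Add x y 20]"
| "compile l (Copy x y) = [Move x y]"
| "compile l (Input x y) = [Load x y]"
| "compile l (Get x j y) = address_code j y @ [Load x 20]"
| "compile l (Put j y x) = address_code j y @ [Store 20 x]"
| "compile l (c ;; d) = compile l c @ compile (l + code_length c) d"
| "compile l (IfNeq x y c d) =
     difference_code x y @ [JumpZero 20 (l + 5 + code_length c)] @ compile (l + 4) c @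
     [Jump (l + 5 + code_length c + code_length d)] @ compile (l + 5 + code_length c) d"
| "compile l (WhileNeq x y c) =
     difference_code x y @ [JumpZero 20 (l + 5 + code_length c)] @ compile (l + 4) c @ [Jump l]"

lemma length_compile [simp]: "length (compile l c) = code_length c"
  by (induction c arbitrary: l) (auto simp: address_code_def difference_code_def)

section \<open>Machine runs of a piece of code, with bounded words\<close>

definition code_at :: "program \<Rightarrow> nat \<Rightarrow> instr list \<Rightarrow> bool" where
  "code_at P l c \<longleftrightarrow> (\<forall>i<length c. l + i < length P \<and> P ! (l + i) = c ! i)"

lemma code_at_Nil [simp]: "code_at P l []"
  by (simp add: code_at_def)

lemma code_at_Cons [simp]:
  "code_at P l (c # cs) \<longleftrightarrow> l < length P \<and> P ! l = c \<and> code_at P (Suc l) cs"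
  by (auto simp: code_at_def All_less_Suc2)

lemma code_at_append [simp]:
  "code_at P l (c @ d) \<longleftrightarrow> code_at P l c \<and> code_at P (l + length c) d"
  by (induction c arbitrary: l) auto

definition reaches :: "program \<Rightarrow> nat \<Rightarrow> nat \<Rightarrow> config \<Rightarrow> config \<Rightarrow> bool" where
  "reaches P W t s s' \<longleftrightarrow> (step P ^^ t) s = s' \<and> (\<forall>j\<le>t. words_bounded W ((step P ^^ j) s))"

lemma reaches_0: "words_bounded W s \<Longrightarrow> reaches P W 0 s s"
  by (simp add: reaches_def)

lemma reaches_trans:
  assumes "reaches P W t s s'" "reaches P W u s' s''"
  shows "reaches P W (t + u) s s''"
  unfolding reaches_def
proof (intro conjI allI impI)
  show "(step P ^^ (t + u)) s = s''"
    using assms by (simp add: reaches_def add.commute[of t] funpow_add)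
next
  fix j assume j: "j \<le> t + u"
  show "words_bounded W ((step P ^^ j) s)"
  proof (cases "j \<le> t")
    case True
    then show ?thesis using assms by (simp add: reaches_def)
  next
    case False
    then obtain i where i: "j = i + t" "i \<le> u"
      using j by (metis add.commute le_Suc_ex nat_add_left_cancel_le nat_le_linear)
    then show ?thesis using assms by (simp add: reaches_def funpow_add)
  qed
qed

lemma reaches_step:
  assumes "code_at P (pc s) (i # is)" "words_bounded W s"
    and "words_bounded W (exec_instr i s)" "reaches P W t (exec_instr i s) s'"
  shows "reaches P W (Suc t) s s'"
proof -
  have "step P s = exec_instr i s"
    using assms(1) by (simp add: step_def halted_def)
  then have "reaches P W 1 s (exec_instr i s)"
    using assms(2,3) by (auto simp: reaches_def le_Suc_eq)
  from reaches_trans[OF this assms(4)] show ?thesis by simp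
qed

text \<open>Only \<open>Const\<close> and \<open>Add\<close> can produce a word larger than all
  present ones; other instructions copy or decrease.\<close>

lemma words_bounded_exec:
  assumes "words_bounded W s"
    and "case i of Const _ k \<Rightarrow> k \<le> W | Add _ j k \<Rightarrow> reg s j + reg s k \<le> W | _ \<Rightarrow> True"
  shows "words_bounded W (exec_instr i s)"
  using assms by (cases i) (auto simp: words_bounded_def intro: le_trans[OF diff_le_self])

fun run_block :: "instr list \<Rightarrow> config \<Rightarrow> config" where
  "run_block [] s = s"
| "run_block (i # is) s = run_block is (exec_instr i s)"

text \<open>A jump is allowed only as the last instruction, because \<open>run_block\<close> goes
  through the list without looking at the program counter.\<close>

fun block_bounded :: "nat \<Rightarrow> instr list \<Rightarrow> config \<Rightarrow> bool" where
  "block_bounded W [] s \<longleftrightarrow> True"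
| "block_bounded W (i # is) s \<longleftrightarrow>
     (case i of Const _ k \<Rightarrow> k \<le> W | Add _ j k \<Rightarrow> reg s j + reg s k \<le> W
        | Jump _ \<Rightarrow> is = [] | JumpZero _ _ \<Rightarrow> is = [] | _ \<Rightarrow> True) \<and>
     block_bounded W is (exec_instr i s)"

lemma reaches_block:
  assumes "code_at P (pc s) is" "words_bounded W s" "block_bounded W is s"
  shows "reaches P W (length is) s (run_block is s) \<and> words_bounded W (run_block is s)"
  using assms
proof (induction "is" arbitrary: s)
  case Nil
  then show ?case by (simp add: reaches_0)
next
  case (Cons i "is")
  have wb: "words_bounded W (exec_instr i s)"
    using Cons.prems by (intro words_bounded_exec) (auto split: instr.splits)
  have "code_at P (pc (exec_instr i s)) is"
    using Cons.prems by (cases i) auto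
  then have "reaches P W (length is) (exec_instr i s) (run_block (i # is) s)
      \<and> words_bounded W (run_block (i # is) s)"
    using Cons.IH[OF _ wb] Cons.prems by simp
  then show ?case
    using reaches_step[OF Cons.prems(1,2) wb] by simp
qed

section \<open>Memory layout and simulation of the structured language\<close>

definition layout :: "nat list \<Rightarrow> (nat \<Rightarrow> nat \<Rightarrow> nat) \<Rightarrow> nat \<Rightarrow> nat" where
  "layout xs A a =
     (if a < length xs then xs ! a else A ((a - length xs) mod 8) ((a - length xs) div 8))"

lemma layout_array: "j < 8 \<Longrightarrow> layout xs A (8 * i + length xs + j) = A j i"
  by (simp add: layout_def)

lemma layout_update:
  assumes "j < 8"
  shows "(layout xs A)(8 * i + length xs + j := z) = layout xs (A(j := (A j)(i := z)))"
proof
  fix a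
  have "a - length xs = 8 * ((a - length xs) div 8) + (a - length xs) mod 8" by simp
  then have "(a - length xs) mod 8 = j \<and> (a - length xs) div 8 = i \<longleftrightarrow> a - length xs = 8 * i + j"
    using assms by (metis add.commute div_less div_mult_self4 mod_less mod_mult_self4 mult.commute
      add.right_neutral add_0 numeral_eq_Suc zero_neq_numeral)
  then show "((layout xs A)(8 * i + length xs + j := z)) a = layout xs (A(j := (A j)(i := z))) a"
    by (auto simp: layout_def)
qed

text \<open>\<open>M\<close> is the cap on values and remaining credits together. Indices are thus
  at most \<open>M\<close>, and the word bound exceeds every address
  \<open>8 * i + length xs + j\<close> with \<open>j < 8\<close>. The scratch registers 20 and 21
  are constrained by that bound alone.\<close>

definition represents ::
  "nat list \<Rightarrow> nat \<Rightarrow> (nat \<Rightarrow> nat) \<Rightarrow> (nat \<Rightarrow> nat \<Rightarrow> nat) \<Rightarrow> nat \<Rightarrow> config \<Rightarrow> bool" where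
  "represents xs M r A k s \<longleftrightarrow>
     (\<forall>x<20. reg s x = r x \<and> r x + k \<le> M) \<and> (\<forall>j i. A j i + k \<le> M) \<and>
     (\<forall>a\<in>set xs. a + k \<le> M) \<and> reg s 22 = length xs \<and> mem s = layout xs A \<and>
     words_bounded (8 * M + length xs + 8) s"

text \<open>Eight instructions per credit suffice: an array access takes seven, a test together with
  the jump at the end of its branch or loop body five.\<close>

abbreviation simulates where
  "simulates P xs M l c k r' A' k' s \<equiv>
     (\<exists>t s'. reaches P (8 * M + length xs + 8) t s s' \<and> pc s' = l + code_length c \<and>
        represents xs M r' A' k' s' \<and> t + 8 * k' \<le> 8 * k)"

lemma represents_Suc: "represents xs M r A (Suc k) s \<Longrightarrow> represents xs M r A k s"
  unfolding represents_def add_Suc_right using Suc_leD by blast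

lemma represents_cong:
  assumes "represents xs M r A k s" "mem s' = mem s" "words_bounded (8 * M + length xs + 8) s'"
    and "\<And>x. x \<noteq> 20 \<Longrightarrow> x \<noteq> 21 \<Longrightarrow> reg s' x = reg s x"
  shows "represents xs M r A k s'"
  using assms unfolding represents_def by simp

lemma representsD:
  assumes "represents xs M r A k s"
  shows "x < 20 \<Longrightarrow> reg s x = r x" "x < 20 \<Longrightarrow> r x + k \<le> M" "A j i + k \<le> M"
    "a < length xs \<Longrightarrow> xs ! a + k \<le> M" "reg s 22 = length xs" "mem s = layout xs A"
    "words_bounded (8 * M + length xs + 8) s"
  using assms unfolding represents_def by simp_all

lemma simulates_block:
  assumes "represents xs M r A (Suc k) s" "code_at P l cs" "pc s = l"
    and "block_bounded (8 * M + length xs + 8) cs s"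
    and "pc (run_block cs s) = l + code_length c" "length cs \<le> 8"
    and "\<And>y. y < 20 \<Longrightarrow> reg (run_block cs s) y = r' y \<and> r' y + k \<le> M"
    and "reg (run_block cs s) 22 = reg s 22"
    and "mem (run_block cs s) = layout xs A'"
    and "\<And>j i. A' j i + k \<le> M"
  shows "simulates P xs M l c (Suc k) r' A' k s"
proof -
  have "words_bounded (8 * M + length xs + 8) s" by (rule representsD(7)[OF assms(1)])
  from reaches_block[of P s cs, OF _ this assms(4)] assms(2,3)
  have *: "reaches P (8 * M + length xs + 8) (length cs) s (run_block cs s)"
    "words_bounded (8 * M + length xs + 8) (run_block cs s)" by simp_all
  moreover have "represents xs M r' A' k (run_block cs s)"
    using assms(7-10) *(2) representsD(5)[OF represents_Suc[OF assms(1)]] represents_Suc[OF assms(1)]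
    unfolding represents_def by simp
  ultimately show ?thesis
    using assms(5,6) by (intro exI[of _ "length cs"] exI[of _ "run_block cs s"]) auto
qed

lemma simulates_assign:
  assumes "represents xs M r A (Suc k) s" "code_at P l cs" "pc s = l"
    and "block_bounded (8 * M + length xs + 8) cs s"
    and "pc (run_block cs s) = l + code_length c" "length cs \<le> 8"
    and "\<And>y. y < 20 \<or> y = 22 \<Longrightarrow> reg (run_block cs s) y = (if y = x then v else reg s y)"
    and "mem (run_block cs s) = mem s" "x < 20" "v + k \<le> M"
  shows "simulates P xs M l c (Suc k) (r(x := v)) A k s"
proof (rule simulates_block[OF assms(1-6)])
  note R = representsD[OF represents_Suc[OF assms(1)]]
  show "reg (run_block cs s) y = (r(x := v)) y \<and> (r(x := v)) y + k \<le> M" if "y < 20" for y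
    using assms(7)[of y] that R(1,2)[of y] assms(10) by simp
  show "reg (run_block cs s) 22 = reg s 22" using assms(7)[of 22] assms(9) by simp
  show "mem (run_block cs s) = layout xs A" using assms(8) R(6) by simp
  show "A j i + k \<le> M" for j i by (rule R(3))
qed

lemma represents_difference:
  assumes "represents xs M r A (Suc k) s" "pc s = l" "x < 20" "y < 20"
    and "code_at P l (difference_code x y @ [JumpZero 20 l'])"
  obtains s' where "reaches P (8 * M + length xs + 8) 4 s s'" "represents xs M r A k s'"
    "pc s' = (if r x = r y then l' else l + 4)"
proof -
  let ?W = "8 * M + length xs + 8"
  let ?is = "difference_code x y @ [JumpZero 20 l']"
  have rx: "reg s x = r x" "reg s y = r y" "r x \<le> M" "r y \<le> M" "words_bounded ?W s"
    using assms(1,3,4) by (auto simp: represents_def add_leD1)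
  have le: "r x - r y + (r y - r x) \<le> ?W" using rx by linarith
  have "block_bounded ?W ?is s"
    using rx assms(3,4) le by (simp add: difference_code_def)
  moreover have "length ?is = 4" by (simp add: difference_code_def)
  moreover have "code_at P (pc s) ?is" using assms(2,5) by simp
  ultimately have *: "reaches P ?W 4 s (run_block ?is s)" "words_bounded ?W (run_block ?is s)"
    using reaches_block[of P s ?is ?W] rx(5) by (simp_all only: simp_thms)
  have "represents xs M r A k (run_block ?is s)"
    by (rule represents_cong[OF represents_Suc[OF assms(1)] _ *(2)])
       (simp_all add: difference_code_def)
  moreover have "pc (run_block ?is s) = (if r x = r y then l' else l + 4)"
    using assms(2-4) rx by (auto simp: difference_code_def)
  ultimately show thesis using * that by blast
qed

lemma simulates_jump:
  assumes "represents xs M r A k s" "code_at P l [Jump l']" "pc s = l"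
  shows "reaches P (8 * M + length xs + 8) 1 s (s\<lparr>pc := l'\<rparr>)"
    "represents xs M r A k (s\<lparr>pc := l'\<rparr>)"
  using reaches_block[of P s "[Jump l']" "8 * M + length xs + 8"] assms representsD(7)[OF assms(1)]
  by (simp_all add: represents_def)

lemma add_4_5: "l + 4 = Suc (Suc (Suc (Suc l)))" "l + 5 = Suc (Suc (Suc (Suc (Suc l))))"
  by simp_all

lemma code_at_IfNeq:
  assumes "code_at P l (compile l (IfNeq x y c d))"
  shows "code_at P l (difference_code x y @ [JumpZero 20 (l + 5 + code_length c)])"
    "code_at P (l + 4) (compile (l + 4) c)"
    "code_at P (l + 4 + code_length c) [Jump (l + 5 + code_length c + code_length d)]"
    "code_at P (l + 5 + code_length c) (compile (l + 5 + code_length c) d)"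
  using assms by (simp_all add: difference_code_def add_4_5)

lemma code_at_WhileNeq:
  assumes "code_at P l (compile l (WhileNeq x y c))"
  shows "code_at P l (difference_code x y @ [JumpZero 20 (l + 5 + code_length c)])"
    "code_at P (l + 4) (compile (l + 4) c)"
    "code_at P (l + 4 + code_length c) [Jump l]"
  using assms by (simp_all add: difference_code_def add_4_5)

text \<open>Induction on the derivation, with position and machine state left general: after the
  body of a loop the same code is entered again at the same position, in a new state.\<close>

lemma simulation:
  assumes "big xs c r A k r' A' k'" "well_formed c" "code_at P l (compile l c)"
    and "represents xs M r A k s" "pc s = l"
  shows "simulates P xs M l c k r' A' k' s"
  using assms
proof (induction arbitrary: l s rule: big.induct)
  case (Skip r A k)
  then show ?case
    by (intro exI[of _ 0] exI[of _ s]) (auto simp: reaches_0 represents_def)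
next
  case (Zero x r A k)
  note R = representsD[OF Zero.prems(3)]
  show ?case
    using Zero.prems R(2)[of x]
    by (intro simulates_assign[OF Zero.prems(3), of P l "[Const x 0]"]) simp_all
next
  case (Inc x y r A k)
  note R = representsD[OF Inc.prems(3)]
  show ?case
    using Inc.prems R(1,2)[of y]
    by (intro simulates_assign[OF Inc.prems(3), of P l "[Const 20 1, Add x y 20]"]) auto
next
  case (Copy x y r A k)
  note R = representsD[OF Copy.prems(3)]
  show ?case
    using Copy.prems R(1,2)[of y]
    by (intro simulates_assign[OF Copy.prems(3), of P l "[Move x y]"]) auto
next
  case (Input r y x A k)
  note R = representsD[OF Input.prems(3)]
  show ?case
    using Input.prems Input.hyps R(1)[of y] R(4)[of "r y"] R(6)
    by (intro simulates_assign[OF Input.prems(3), of P l "[Load x y]"]) (simp_all add: layout_def)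
next
  case (Get x j y r A k)
  note R = representsD[OF Get.prems(3)]
  have e: "r y + r y + (r y + r y) + (r y + r y + (r y + r y)) = 8 * r y" by simp
  show ?case
    using Get.prems R(1,2)[of y] R(3)[of j "r y"] R(5,6)
    by (intro simulates_assign[OF Get.prems(3), of P l "compile l (Get x j y)"])
       (auto simp: address_code_def layout_array e)
next
  case (Put j y x r A k)
  note R = representsD[OF Put.prems(3)]
  have e: "r y + r y + (r y + r y) + (r y + r y + (r y + r y)) = 8 * r y" by simp
  have "A j' i + k \<le> M" "z < 20 \<Longrightarrow> r z + k \<le> M" for j' i z
    using R(2)[of z] R(3)[of j' i] by simp_all
  then show ?case
    using Put.prems R(1,2)[of y] R(1,2)[of x] R(1) R(5,6)
    by (intro simulates_block[OF Put.prems(3), of P l "compile l (Put j y x)"])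
       (auto simp: address_code_def layout_update e, auto intro!: arg_cong[where f = "layout xs"])
next
  case (Seq c r A k r' A' k' d r'' A'' k'')
  then have "simulates P xs M l c k r' A' k' s" by simp
  then obtain t s' where 1: "reaches P (8 * M + length xs + 8) t s s'" "pc s' = l + code_length c"
    "represents xs M r' A' k' s'" "t + 8 * k' \<le> 8 * k" by blast
  then have "simulates P xs M (l + code_length c) d k' r'' A'' k'' s'"
    using Seq by simp
  then obtain u s'' where 2: "reaches P (8 * M + length xs + 8) u s' s''"
    "pc s'' = l + code_length c + code_length d"
    "represents xs M r'' A'' k'' s''" "u + 8 * k'' \<le> 8 * k'" by blast
  show ?case
    using reaches_trans[OF 1(1) 2(1)] 1 2
    by (intro exI[of _ "t + u"] exI[of _ s'']) auto
next
  case (IfNeq r x y c A k r' A' k' d)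
  let ?W = "8 * M + length xs + 8"
  let ?e = "l + 5 + code_length c + code_length d"
  have wf: "x < 20" "y < 20" "well_formed c" using IfNeq.prems(1) by simp_all
  note code = code_at_IfNeq[OF IfNeq.prems(2)]
  obtain s1 where 1: "reaches P ?W 4 s s1" "represents xs M r A k s1" "pc s1 = l + 4"
    using represents_difference[OF IfNeq.prems(3,4) wf(1,2) code(1)] IfNeq.hyps(1) by auto
  obtain t s2 where 2: "reaches P ?W t s1 s2" "pc s2 = l + 4 + code_length c"
    "represents xs M r' A' k' s2" "t + 8 * k' \<le> 8 * k"
    using IfNeq.IH[OF wf(3) code(2) 1(2,3)] by blast
  from simulates_jump[OF 2(3) code(3) 2(2)]
  have 3: "reaches P ?W 1 s2 (s2\<lparr>pc := ?e\<rparr>)" "represents xs M r' A' k' (s2\<lparr>pc := ?e\<rparr>)" .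
  show ?case
    using reaches_trans[OF reaches_trans[OF 1(1) 2(1)] 3(1)] 3(2) 2(4)
    by (intro exI[of _ "4 + t + 1"] exI[of _ "s2\<lparr>pc := ?e\<rparr>"]) simp
next
  case (IfEq r x y d A k r' A' k' c)
  let ?W = "8 * M + length xs + 8"
  have wf: "x < 20" "y < 20" "well_formed d" using IfEq.prems(1) by simp_all
  note code = code_at_IfNeq[OF IfEq.prems(2)]
  obtain s1 where 1: "reaches P ?W 4 s s1" "represents xs M r A k s1" "pc s1 = l + 5 + code_length c"
    using represents_difference[OF IfEq.prems(3,4) wf(1,2) code(1)] IfEq.hyps(1) by auto
  obtain t s2 where 2: "reaches P ?W t s1 s2" "pc s2 = l + 5 + code_length c + code_length d"
    "represents xs M r' A' k' s2" "t + 8 * k' \<le> 8 * k"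
    using IfEq.IH[OF wf(3) code(4) 1(2,3)] by blast
  show ?case
    using reaches_trans[OF 1(1) 2(1)] 2(2-4)
    by (intro exI[of _ "4 + t"] exI[of _ s2]) simp
next
  case (WhileNeq r x y c A k r' A' k' r'' A'' k'')
  let ?W = "8 * M + length xs + 8"
  have wf: "x < 20" "y < 20" "well_formed c" using WhileNeq.prems(1) by simp_all
  note code = code_at_WhileNeq[OF WhileNeq.prems(2)]
  obtain s1 where 1: "reaches P ?W 4 s s1" "represents xs M r A k s1" "pc s1 = l + 4"
    using represents_difference[OF WhileNeq.prems(3,4) wf(1,2) code(1)] WhileNeq.hyps(1) by auto
  obtain t s2 where 2: "reaches P ?W t s1 s2" "pc s2 = l + 4 + code_length c"
    "represents xs M r' A' k' s2" "t + 8 * k' \<le> 8 * k"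
    using WhileNeq.IH(1)[OF wf(3) code(2) 1(2,3)] by blast
  from simulates_jump[OF 2(3) code(3) 2(2)]
  have 3: "reaches P ?W 1 s2 (s2\<lparr>pc := l\<rparr>)" "represents xs M r' A' k' (s2\<lparr>pc := l\<rparr>)" .
  obtain u s3 where 4: "reaches P ?W u (s2\<lparr>pc := l\<rparr>) s3"
    "pc s3 = l + code_length (WhileNeq x y c)"
    "represents xs M r'' A'' k'' s3" "u + 8 * k'' \<le> 8 * k'"
    using WhileNeq.IH(2)[OF WhileNeq.prems(1,2) 3(2)] by auto
  show ?case
    using reaches_trans[OF reaches_trans[OF reaches_trans[OF 1(1) 2(1)] 3(1)] 4(1)] 2(4) 4(2-4)
    by (intro exI[of _ "4 + t + 1 + u"] exI[of _ s3]) simp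
next
  case (WhileEq r x y c A k)
  have wf: "x < 20" "y < 20" using WhileEq.prems(1) by simp_all
  note code = code_at_WhileNeq[OF WhileEq.prems(2)]
  obtain s1 where 1: "reaches P (8 * M + length xs + 8) 4 s s1" "represents xs M r A k s1"
    "pc s1 = l + 5 + code_length c"
    using represents_difference[OF WhileEq.prems(3,4) wf code(1)] WhileEq.hyps(1) by auto
  then show ?case by (intro exI[of _ 4] exI[of _ s1]) simp
qed

section \<open>Total correctness with credits\<close>

text \<open>A derivation exists only if the credits suffice, so this expresses termination and
  running time as well as the result.\<close>

definition wp where
  "wp xs c Q r A k \<longleftrightarrow> (\<exists>r' A' k'. big xs c r A k r' A' k' \<and> Q r' A' k')"

inductive_cases big_elims:
  "big xs Skip r A k r' A' k'" "big xs (Zero x) r A k r' A' k'" "big xs (Inc x y) r A k r' A' k'"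
  "big xs (Copy x y) r A k r' A' k'" "big xs (Input x y) r A k r' A' k'"
  "big xs (Get x j y) r A k r' A' k'" "big xs (Put j y x) r A k r' A' k'"
  "big xs (c ;; d) r A k r' A' k'" "big xs (IfNeq x y c d) r A k r' A' k'"

lemma wp_simps [simp]:
  "wp xs Skip Q r A k \<longleftrightarrow> Q r A k"
  "wp xs (Zero x) Q r A k \<longleftrightarrow> 0 < k \<and> Q (r(x := 0)) A (k - 1)"
  "wp xs (Inc x y) Q r A k \<longleftrightarrow> 0 < k \<and> Q (r(x := Suc (r y))) A (k - 1)"
  "wp xs (Copy x y) Q r A k \<longleftrightarrow> 0 < k \<and> Q (r(x := r y)) A (k - 1)"
  "wp xs (Input x y) Q r A k \<longleftrightarrow> 0 < k \<and> r y < length xs \<and> Q (r(x := xs ! r y)) A (k - 1)"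
  "wp xs (Get x j y) Q r A k \<longleftrightarrow> 0 < k \<and> Q (r(x := A j (r y))) A (k - 1)"
  "wp xs (Put j y x) Q r A k \<longleftrightarrow> 0 < k \<and> Q r (A(j := (A j)(r y := r x))) (k - 1)"
  "wp xs (c ;; d) Q r A k \<longleftrightarrow> wp xs c (wp xs d Q) r A k"
  unfolding wp_def by (cases k; fastforce elim!: big_elims intro: big.intros)+

lemma wp_IfNeq [simp]:
  "wp xs (IfNeq x y c d) Q r A k \<longleftrightarrow>
     0 < k \<and> (if r x \<noteq> r y then wp xs c Q r A (k - 1) else wp xs d Q r A (k - 1))"
proof -
  have "big xs (IfNeq x y c d) r A k r' A' k' \<longleftrightarrow> 0 < k \<and>
      (if r x \<noteq> r y then big xs c r A (k - 1) r' A' k' else big xs d r A (k - 1) r' A' k')"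
    for r' A' k'
    using big.IfNeq[of r x y xs c A "k - 1" r' A' k' d] big.IfEq[of r x y xs d A "k - 1" r' A' k' c]
    by (cases k) (auto elim: big_elims)
  then show ?thesis unfolding wp_def by auto
qed

lemma wp_mono: "wp xs c Q r A k \<Longrightarrow> (\<And>r A k. Q r A k \<Longrightarrow> Q' r A k) \<Longrightarrow> wp xs c Q' r A k"
  unfolding wp_def by blast

lemma big_credit: "big xs c r A k r' A' k' \<Longrightarrow> k' \<le> k"
  by (induction rule: big.induct) auto

text \<open>No separate termination measure is needed, since every test of the loop condition costs
  a credit.\<close>

lemma wp_WhileNeq:
  assumes "I r A k"
    and "\<And>r A k. I r A k \<Longrightarrow> r x \<noteq> r y \<Longrightarrow> 0 < k \<and> wp xs c I r A (k - 1)"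
    and "\<And>r A k. I r A k \<Longrightarrow> r x = r y \<Longrightarrow> 0 < k \<and> Q r A (k - 1)"
  shows "wp xs (WhileNeq x y c) Q r A k"
  using assms(1)
proof (induction k arbitrary: r A rule: less_induct)
  case (less k)
  show ?case
  proof (cases "r x = r y")
    case True
    with assms(3)[OF less.prems] obtain j where j: "k = Suc j" "Q r A j" by (cases k) auto
    have "big xs (WhileNeq x y c) r A (Suc j) r A j" using True by (rule big.WhileEq)
    with j show ?thesis unfolding wp_def by blast
  next
    case False
    with assms(2)[OF less.prems] obtain j r' A' k' where
      1: "k = Suc j" "big xs c r A j r' A' k'" "I r' A' k'" by (cases k) (auto simp: wp_def)
    have "k' < k" using big_credit[OF 1(2)] 1(1) by simp
    then obtain r'' A'' k'' where
      2: "big xs (WhileNeq x y c) r' A' k' r'' A'' k''" "Q r'' A'' k''"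
      using less.IH 1(3) unfolding wp_def by blast
    have "big xs (WhileNeq x y c) r A (Suc j) r'' A'' k''"
      using False 1(2) 2(1) by (rule big.WhileNeq)
    with 1(1) 2(2) show ?thesis unfolding wp_def by blast
  qed
qed


subsection \<open>The program\<close>

text \<open>
  Scalar variables: 0 result, 1 constantly zero, 2 number of vertices, 3 loop vertex, 4 current vertex
  \<open>w\<close>, 5 the neighbour \<open>x\<close> defining the new class, 9 and 10 head and tail of the queue, 11 the new
  label \<open>w + 1\<close>; the others are local.
  Arrays: 0 and 1 labels of the two sides, 2 marks (\<open>w + 1\<close> is only ever written into \<open>N[w]\<close>),
  3 queue, 4 and 5 sizes of the label classes.
\<close>

definition for_neighbours :: "nat \<Rightarrow> nat \<Rightarrow> nat \<Rightarrow> nat \<Rightarrow> com \<Rightarrow> com" where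
  "for_neighbours v i e u c =
     Inc i v ;; Inc e i ;; Input i i ;; Input e e ;; WhileNeq i e (Input u i ;; Inc i i ;; c)"

definition for_vertices :: "com \<Rightarrow> com" where
  "for_vertices c = Zero 3 ;; WhileNeq 3 2 (c ;; Inc 3 3)"

text \<open>Register 17 is not reset, so the caller chooses where counting starts: at 0 in
  \<open>check_cliques\<close>, at an address in \<open>find_non_dominating\<close>.\<close>

definition count_equal :: "nat \<Rightarrow> nat \<Rightarrow> nat \<Rightarrow> nat \<Rightarrow> nat \<Rightarrow> nat \<Rightarrow> com" where
  "count_equal j x v i e u =
     for_neighbours v i e u (Get 12 j u ;; IfNeq 12 x Skip (Inc 17 17))"

definition side :: "bool \<Rightarrow> nat" where
  "side s = (if s then 1 else 0)"

definition labels :: "(nat \<Rightarrow> nat \<Rightarrow> nat) \<Rightarrow> bool \<Rightarrow> nat \<Rightarrow> nat" where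
  "labels A s = A (side s)"

definition mark :: com where
  "mark = Inc 11 4 ;; Put 2 4 11 ;; for_neighbours 4 6 7 8 (Put 2 8 11)"

definition assign_label :: "bool \<Rightarrow> nat \<Rightarrow> com" where
  "assign_label s y = Put (side s) y 11 ;; Put 3 10 y ;; Inc 10 10"

text \<open>Registers 4 and 5 hold \<open>w\<close> and \<open>x\<close>; equality means the
  singleton class. Both are labelled before the loop, which therefore finds \<open>w\<close> already
  labelled and does not queue it twice.\<close>

definition assign_class :: "bool \<Rightarrow> com" where
  "assign_class s =
     assign_label s 4 ;;
     IfNeq 4 5
       (assign_label s 5 ;;
        for_neighbours 5 6 7 8
          (Get 12 2 8 ;;
           IfNeq 12 11 Skip (Get 12 (side s) 8 ;; IfNeq 12 1 Skip (assign_label s 8))))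
       Skip"

text \<open>The default \<open>x = w\<close>, meaning the singleton, survives if no neighbour
  qualifies. If several do, the last one is kept; any of them would serve.\<close>

definition find_outside :: "bool \<Rightarrow> com" where
  "find_outside s =
     Copy 5 4 ;; Get 13 (side (\<not> s)) 4 ;;
     for_neighbours 4 6 7 8
       (Get 12 (side s) 8 ;;
        IfNeq 12 1 Skip (Get 12 (side (\<not> s)) 8 ;; IfNeq 12 13 (Copy 5 8) Skip))"

definition find_non_dominating :: com where
  "find_non_dominating =
     Copy 5 4 ;; Zero 18 ;;
     for_neighbours 4 6 7 8
       (IfNeq 18 1 Skip
         (Get 12 0 8 ;;
          IfNeq 12 1 Skip
            (Copy 5 8 ;; Inc 17 4 ;; Input 17 17 ;; count_equal 2 11 8 14 15 16 ;;
             IfNeq 17 7 (Inc 18 1) Skip)))"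

definition same_except :: "nat set \<Rightarrow> (nat \<Rightarrow> 'b) \<Rightarrow> (nat \<Rightarrow> 'b) \<Rightarrow> bool" where
  "same_except S r r' \<longleftrightarrow> (\<forall>x. x \<notin> S \<longrightarrow> r' x = r x)"

lemma same_exceptD: "same_except S r r' \<Longrightarrow> x \<notin> S \<Longrightarrow> r' x = r x"
  by (simp add: same_except_def)

section \<open>The input encoding and the rules for the two kinds of loops\<close>

locale adjacency_graph =
  fixes al :: "nat list list"
  assumes distinct_al: "v < length al \<Longrightarrow> distinct (al ! v)"
    and al_less: "v < length al \<Longrightarrow> u \<in> set (al ! v) \<Longrightarrow> u < length al"
    and al_sym: "v < length al \<Longrightarrow> u \<in> set (al ! v) \<Longrightarrow> v \<in> set (al ! u)"
    and al_irrefl: "v < length al \<Longrightarrow> v \<notin> set (al ! v)"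
begin

abbreviation n where "n \<equiv> length al"
abbreviation N where "N v \<equiv> set (al ! v)"
abbreviation deg where "deg v \<equiv> length (al ! v)"
abbreviation xs where "xs \<equiv> encode_adjacency_lists al"

definition start :: "nat \<Rightarrow> nat" where
  "start v = n + 2 + length (concat (take v al))"

sublocale indexed_graph n N
  using al_less al_sym al_irrefl by unfold_locales

lemma encoding:
  "xs = n # map start [0..<n + 1] @ concat al"
  by (simp add: encode_adjacency_lists_def start_def Let_def)

lemma length_encoding: "length xs = n + 2 + length (concat al)"
  by (simp add: encoding)

lemma encoding_0: "xs ! 0 = n"
  by (simp add: encoding)

lemma encoding_start: "v \<le> n \<Longrightarrow> xs ! Suc v = start v"
  by (simp add: encoding nth_append del: upt_Suc)

lemma start_Suc: "v < n \<Longrightarrow> start (Suc v) = start v + deg v"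
  by (simp add: start_def take_Suc_conv_app_nth)

lemma start_le: "v \<le> n \<Longrightarrow> start v \<le> length xs"
  by (metis append_take_drop_id concat_append length_append length_encoding le_add1
      nat_add_left_cancel_le start_def)

lemma encoding_neighbour:
  assumes "v < n" "m < deg v"
  shows "xs ! (start v + m) = al ! v ! m" "start v + m < length xs"
proof -
  have "concat al = concat (take v al) @ al ! v @ concat (drop (Suc v) al)"
    by (metis assms(1) concat.simps(2) concat_append id_take_nth_drop)
  then show "xs ! (start v + m) = al ! v ! m"
    using assms(2) by (simp add: encoding start_def nth_append del: upt_Suc)
  show "start v + m < length xs"
    using start_Suc[OF assms(1)] start_le[of "Suc v"] assms by simp
qed

text \<open>Preparing the two bounds costs four credits, and each round costs three before the body:
  the loop test, \<open>Input\<close> and \<open>Inc\<close>. The body starts with \<open>i\<close>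
  already advanced, which is why it must leave \<open>i\<close> at
  \<open>Suc (start w + m)\<close>.\<close>

lemma wp_for_neighbours:
  assumes "r v = w" "w < n" "i \<noteq> e" "u \<noteq> i" "u \<noteq> e" "4 \<le> k"
    and "Inv 0 (r(i := start w, e := start w + deg w)) A (k - 4)"
    and "\<And>m r A k. m < deg w \<Longrightarrow> Inv m r A k \<Longrightarrow> r i = start w + m \<Longrightarrow> r e = start w + deg w \<Longrightarrow>
      3 \<le> k \<and> wp xs c (\<lambda>r' A' k'. r' i = Suc (start w + m) \<and> r' e = start w + deg w \<and>
        Inv (Suc m) r' A' k') (r(u := al ! w ! m, i := Suc (start w + m))) A (k - 3)"
    and "\<And>r A k. Inv (deg w) r A k \<Longrightarrow> r i = start w + deg w \<Longrightarrow> r e = start w + deg w \<Longrightarrow>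
      1 \<le> k \<and> Q r A (k - 1)"
  shows "wp xs (for_neighbours v i e u c) Q r A k"
proof -
  let ?I = "\<lambda>r A k. \<exists>m\<le>deg w. r i = start w + m \<and> r e = start w + deg w \<and> Inv m r A k"
  have len: "Suc (Suc w) < length xs" "xs ! Suc w = start w"
    "xs ! Suc (Suc w) = start w + deg w"
    using assms(2) encoding_start[of w] encoding_start[of "Suc w"] start_Suc length_encoding by auto
  have upd: "r(i := a, e := b, i := c, e := d) = r(i := c, e := d)" for a b c d
    using assms(3) by auto
  have "wp xs (WhileNeq i e (Input u i ;; Inc i i ;; c)) Q
      (r(i := start w, e := start w + deg w)) A (k - 4)"
  proof (rule wp_WhileNeq[where I = ?I])
    show "?I (r(i := start w, e := start w + deg w)) A (k - 4)"
      using assms(3,7) by (intro exI[of _ 0]) auto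
  next
    fix r A k assume "?I r A k" "r i \<noteq> r e"
    then obtain m where m: "m < deg w" "r i = start w + m" "r e = start w + deg w" "Inv m r A k"
      by (auto simp: le_less)
    have wp: "3 \<le> k" "wp xs c (\<lambda>r' A' k'. r' i = Suc (start w + m) \<and> r' e = start w + deg w \<and>
        Inv (Suc m) r' A' k') (r(u := al ! w ! m, i := Suc (start w + m))) A (k - 3)"
      using assms(8)[OF m(1,4,2,3)] by auto
    have "wp xs c ?I (r(u := al ! w ! m, i := Suc (start w + m))) A (k - 3)"
      using m(1) by (intro wp_mono[OF wp(2)]) (auto intro!: exI[of _ "Suc m"])
    then show "0 < k \<and> wp xs (Input u i ;; Inc i i ;; c) ?I r A (k - 1)"
      using wp(1) m(2) encoding_neighbour[OF assms(2) m(1)] assms(4) by (simp add: numeral_eq_Suc)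
  next
    fix r A k assume "?I r A k" "r i = r e"
    then show "0 < k \<and> Q r A (k - 1)" using assms(9)[of r A k] by auto
  qed
  then show ?thesis
    using len assms(1,3,6) upd unfolding for_neighbours_def by (simp add: numeral_eq_Suc)
qed

lemma wp_for_vertices:
  assumes "r 2 = n" "1 \<le> k" "Inv 0 (r(3 := 0)) A (k - 1)"
    and "\<And>v r A k. v < n \<Longrightarrow> r 3 = v \<Longrightarrow> r 2 = n \<Longrightarrow> Inv v r A k \<Longrightarrow>
      1 \<le> k \<and> wp xs c (\<lambda>r' A' k'. r' 3 = v \<and> r' 2 = n \<and> 1 \<le> k' \<and>
        Inv (Suc v) (r'(3 := Suc v)) A' (k' - 1)) r A (k - 1)"
    and "\<And>r A k. r 2 = n \<Longrightarrow> Inv n r A k \<Longrightarrow> 1 \<le> k \<and> Q r A (k - 1)"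
  shows "wp xs (for_vertices c) Q r A k"
proof -
  let ?I = "\<lambda>r A k. r 3 \<le> n \<and> r 2 = n \<and> Inv (r 3) r A k"
  have "wp xs (WhileNeq 3 2 (c ;; Inc 3 3)) Q (r(3 := 0)) A (k - 1)"
  proof (rule wp_WhileNeq[where I = ?I])
    show "?I (r(3 := 0)) A (k - 1)" using assms(1,3) by simp
  next
    fix r A k assume I: "?I r A k" "r 3 \<noteq> r 2"
    then have "r 3 < n" by simp
    with assms(4)[of "r 3" r A k] I have
      wp: "1 \<le> k" "wp xs c (\<lambda>r' A' k'. r' 3 = r 3 \<and> r' 2 = n \<and> 1 \<le> k' \<and>
        Inv (Suc (r 3)) (r'(3 := Suc (r 3))) A' (k' - 1)) r A (k - 1)" by auto
    have "wp xs c (\<lambda>r A k. 0 < k \<and> ?I (r(3 := Suc (r 3))) A (k - 1)) r A (k - 1)"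
      using \<open>r 3 < n\<close> by (intro wp_mono[OF wp(2)]) auto
    then have "wp xs c (wp xs (Inc 3 3) ?I) r A (k - 1)"
      by (rule wp_mono) simp
    then show "0 < k \<and> wp xs (c ;; Inc 3 3) ?I r A (k - 1)"
      using wp(1) by simp
  next
    fix r A k assume "?I r A k" "r 3 = r 2"
    then show "0 < k \<and> Q r A (k - 1)" using assms(5)[of r A k] by auto
  qed
  then show ?thesis using assms(2) unfolding for_vertices_def by simp
qed

lemma take_Suc_nth: "m < deg w \<Longrightarrow> set (take (Suc m) (al ! w)) = insert (al ! w ! m) (set (take m (al ! w)))"
  by (simp add: take_Suc_conv_app_nth)

lemma nth_notin_take:
  assumes "w < n" "m < deg w"
  shows "al ! w ! m \<notin> set (take m (al ! w))"
  using distinct_al[OF assms(1)] assms(2) by (auto simp: in_set_conv_nth nth_eq_iff_index_eq)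

lemma wp_mark:
  assumes "r 4 = w" "w < n" "7 + 4 * deg w \<le> k"
    and "\<And>r' A' k'. same_except {6, 7, 8, 11} r r' \<Longrightarrow> r' 11 = Suc w \<Longrightarrow>
      same_except {2} A A' \<Longrightarrow> A' 2 = (\<lambda>y. if y = w \<or> y \<in> N w then Suc w else A 2 y) \<Longrightarrow>
      k \<le> k' + 7 + 4 * deg w \<Longrightarrow> Q r' A' k'"
  shows "wp xs mark Q r A k"
proof -
  let ?A = "A(2 := (A 2)(w := Suc w))" and ?r = "r(11 := Suc w)"
  \<comment> \<open>Of the two credit clauses, the first bounds what has been spent and the second
    reserves enough for the remaining rounds and the final test. The pattern recurs in later loop
    invariants.\<close>
  let ?Inv = "\<lambda>m r' A' k'. same_except {6, 7, 8, 11} r r' \<and> r' 11 = Suc w \<and> same_except {2} A A' \<and>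
      A' 2 = (\<lambda>y. if y = w \<or> y \<in> set (take m (al ! w)) then Suc w else A 2 y) \<and>
      k \<le> k' + 6 + 4 * m \<and> 1 + 4 * deg w \<le> k' + 4 * m"
  have "wp xs (for_neighbours 4 6 7 8 (Put 2 8 11)) Q ?r ?A (k - 2)"
  proof (rule wp_for_neighbours[where w = w and Inv = ?Inv], goal_cases)
    case (8 m r' A' k')
    then show ?case
      by (auto simp: same_except_def take_Suc_nth fun_eq_iff)
  next
    case (9 r' A' k')
    then show ?case using assms(4)[of r' A' "k' - 1"] by auto
  qed (use assms in \<open>auto simp: same_except_def\<close>)
  then show ?thesis using assms(1,3) unfolding mark_def by (simp add: numeral_2_eq_2)
qed

lemma wp_count_equal:
  assumes "r v = w" "w < n" "distinct [x, i, e, u, 12, 17]" "5 + 6 * deg w \<le> k"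
    and "\<And>r' k'. same_except {12, 17, i, e, u} r r' \<Longrightarrow>
      r' 17 = r 17 + card {z \<in> N w. A j z = r x} \<Longrightarrow> k \<le> k' + 5 + 6 * deg w \<Longrightarrow> Q r' A k'"
  shows "wp xs (count_equal j x v i e u) Q r A k"
proof -
  let ?Inv = "\<lambda>m r' A' k'. same_except {12, 17, i, e, u} r r' \<and> A' = A \<and>
      r' 17 = r 17 + card {z \<in> set (take m (al ! w)). A j z = r x} \<and>
      k \<le> k' + 4 + 6 * m \<and> 1 + 6 * deg w \<le> k' + 6 * m"
  show ?thesis unfolding count_equal_def
  proof (rule wp_for_neighbours[where w = w and Inv = ?Inv], goal_cases)
    case (8 m r' A' k')
    let ?z = "al ! w ! m"
    have "{z \<in> set (take (Suc m) (al ! w)). A j z = r x} =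
        (if A j ?z = r x then insert ?z {z \<in> set (take m (al ! w)). A j z = r x}
         else {z \<in> set (take m (al ! w)). A j z = r x})"
      using take_Suc_nth[OF 8(1)] by auto
    then have c: "card {z \<in> set (take (Suc m) (al ! w)). A j z = r x} =
        card {z \<in> set (take m (al ! w)). A j z = r x} + (if A j ?z = r x then 1 else 0)"
      using nth_notin_take[OF assms(2) 8(1)] by simp
    show ?case using 8 assms(3) c by (auto simp: same_except_def)
  next
    case (9 r' A' k')
    then show ?case using assms(5)[of r' "k' - 1"] by auto
  qed (use assms in \<open>auto simp: same_except_def\<close>)
qed

end


lemma side_neq [simp]: "side s \<noteq> 2" "side s \<noteq> 3" "side s \<noteq> 4" "side s \<noteq> 5"
  "side (\<not> s) \<noteq> side s" "side s \<noteq> side (\<not> s)"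
  by (simp_all add: side_def)

section \<open>Finding and labelling a new class\<close>

text \<open>The new segment has exactly \<open>card S\<close> cells and image \<open>S\<close>, so
  it has no repetitions: each new label accounts for one queue entry.\<close>

definition queue_extends ::
  "nat \<Rightarrow> (nat \<Rightarrow> nat) \<Rightarrow> nat \<Rightarrow> (nat \<Rightarrow> nat) \<Rightarrow> nat set \<Rightarrow> bool" where
  "queue_extends t q t' q' S \<longleftrightarrow>
     finite S \<and> t' = t + card S \<and> same_except {t..<t'} q q' \<and> q' ` {t..<t'} = S"

lemma queue_extends_empty: "queue_extends t q t q {}"
  by (simp add: queue_extends_def same_except_def)

lemma queue_extends_push:
  assumes "queue_extends t q t' q' S" "z \<notin> S"
  shows "queue_extends t q (Suc t') (q'(t' := z)) (insert z S)"
proof -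
  have "{t..<Suc t'} = insert t' {t..<t'}"
    using assms(1) by (auto simp: queue_extends_def)
  moreover have "q' ` {t..<t'} = S"
    using assms(1) unfolding queue_extends_def by blast
  moreover have "(q'(t' := z)) ` {t..<t'} = q' ` {t..<t'}"
    by (intro image_cong) auto
  ultimately have "(q'(t' := z)) ` {t..<Suc t'} = insert z S"
    using \<open>q' ` {t..<t'} = S\<close> by (simp only: image_insert fun_upd_same)
  moreover have "same_except {t..<Suc t'} q (q'(t' := z))"
    using assms(1) unfolding queue_extends_def same_except_def
    by (metis atLeastLessThan_iff fun_upd_other less_SucI lessI le_add1)
  moreover have "finite (insert z S)" "Suc t' = t + card (insert z S)"
    using assms by (simp_all add: queue_extends_def)
  ultimately show ?thesis unfolding queue_extends_def by blast
qed

context adjacency_graph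
begin

definition closed :: "nat \<Rightarrow> nat set" where
  "closed v = insert v (N v)"

lemma labels_relabelI:
  assumes "A' (side s) = (\<lambda>y. if y \<in> new_class (labels A) s w x then Suc w else A (side s) y)"
    and "same_except {side s, 3} A A'"
  shows "labels A' = relabel (labels A) s w x"
proof
  fix s'
  show "labels A' s' = relabel (labels A) s w x s'"
  proof (cases "s' = s")
    case True
    then show ?thesis using assms(1) by (simp add: labels_def relabel_def cong: if_cong)
  next
    case False
    then have "s' = (\<not> s)" by auto
    then show ?thesis
      using same_exceptD[OF assms(2), of "side s'"] by (simp add: labels_def relabel_def)
  qed
qed

text \<open>Only the list of \<open>x\<close> is read, and \<open>x\<close> itself receives a label,
  which later pays for this.\<close>

lemma wp_assign_class:
  assumes r: "r 1 = 0" "r 4 = w" "r 5 = x" "r 11 = Suc w" and w: "w < n"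
    and L: "labels A s w = 0" "x \<noteq> w \<Longrightarrow> x \<in> N w \<and> labels A s x = 0"
    and marks: "\<And>y. y < n \<Longrightarrow> A 2 y = Suc w \<longleftrightarrow> y \<in> closed w"
    and k: "12 + 10 * deg x \<le> k"
    and Q: "\<And>r' A' k'. same_except {6, 7, 8, 10, 12} r r' \<Longrightarrow> same_except {side s, 3} A A' \<Longrightarrow>
      labels A' = relabel (labels A) s w x \<Longrightarrow>
      queue_extends (r 10) (A 3) (r' 10) (A' 3) (new_class (labels A) s w x) \<Longrightarrow>
      k \<le> k' + 12 + 10 * deg x \<Longrightarrow> Q r' A' k'"
  shows "wp xs (assign_class s) Q r A k"
proof (cases "x = w")
  case True
  let ?A = "A(side s := (A (side s))(w := Suc w), 3 := (A 3)(r 10 := w))"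
    and ?r = "r(10 := Suc (r 10))"
  have NC: "new_class (labels A) s w x = {w}" using True by (simp add: new_class_def)
  have "Q ?r ?A (k - 4)"
  proof (rule Q)
    show "labels ?A = relabel (labels A) s w x"
      by (rule labels_relabelI) (auto simp: NC same_except_def)
    show "queue_extends (r 10) (A 3) (?r 10) (?A 3) (new_class (labels A) s w x)"
      using queue_extends_push[OF queue_extends_empty, of w "r 10" "A 3"] NC by simp
  qed (auto simp: same_except_def)
  moreover have "k - Suc (Suc (Suc (Suc 0))) = k - 4" by simp
  ultimately show ?thesis
    using True r k by (simp add: assign_class_def assign_label_def)
next
  case False
  then have x: "x \<in> N w" "labels A s x = 0" "x < n" using L(2) al_less w by auto
  define C where "C m = insert w (insert x {y \<in> set (take m (al ! x)). y \<in> closed w \<and> labels A s y = 0})"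
    for m
  let ?A = "A(side s := (A (side s))(w := Suc w, x := Suc w), 3 := (A 3)(r 10 := w, Suc (r 10) := x))"
    and ?r = "r(10 := Suc (Suc (r 10)))"
  let ?Inv = "\<lambda>m r' A' k'. same_except {6, 7, 8, 10, 12} r r' \<and> same_except {side s, 3} A A' \<and>
      A' (side s) = (\<lambda>y. if y \<in> C m then Suc w else A (side s) y) \<and>
      queue_extends (r 10) (A 3) (r' 10) (A' 3) (C m) \<and>
      k \<le> k' + 11 + 10 * m \<and> 1 + 10 * deg x \<le> k' + 10 * m"
  have C0: "C 0 = {w, x}" by (auto simp: C_def)
  have Cdeg: "C (deg x) = new_class (labels A) s w x"
    using False by (auto simp: C_def new_class_def closed_def)
  have "wp xs (for_neighbours 5 6 7 8 (Get 12 2 8 ;;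
           IfNeq 12 11 Skip (Get 12 (side s) 8 ;; IfNeq 12 1 Skip (assign_label s 8)))) Q ?r ?A (k - 7)"
  proof (rule wp_for_neighbours[where w = x and Inv = ?Inv], goal_cases)
    case 1
    then show ?case using r by simp
  next
    case 2
    then show ?case using x by simp
  next
    case 7
    have "queue_extends (r 10) (A 3) (Suc (Suc (r 10))) ((A 3)(r 10 := w, Suc (r 10) := x)) {w, x}"
      using queue_extends_push[OF queue_extends_push[OF queue_extends_empty, of w "r 10" "A 3"], of x]
        False by (simp add: insert_commute)
    then show ?case using k C0 by (auto simp: same_except_def)
  next
    case (8 m r' A' k')
    let ?z = "al ! x ! m"
    have z: "?z < n" "?z \<in> N x" using 8(1) x al_less by auto
    have CSuc: "C (Suc m) = (if ?z \<in> closed w \<and> labels A s ?z = 0 then insert ?z (C m) else C m)"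
      using take_Suc_nth[OF 8(1)] by (auto simp: C_def)
    have I: "same_except {6, 7, 8, 10, 12} r r'" "same_except {side s, 3} A A'"
      "A' (side s) = (\<lambda>y. if y \<in> C m then Suc w else A (side s) y)"
      "queue_extends (r 10) (A 3) (r' 10) (A' 3) (C m)"
      "k \<le> k' + 11 + 10 * m" "1 + 10 * deg x \<le> k' + 10 * m" using 8(2) by auto
    have r': "r' 1 = 0" "r' 11 = Suc w" using same_exceptD[OF I(1)] r by auto
    have A2: "A' 2 ?z = Suc w \<longleftrightarrow> ?z \<in> closed w"
      using same_exceptD[OF I(2), of 2] marks[OF z(1)] side_neq(1)[of s] by auto
    have k': "11 \<le> k'" using I(6) 8(1) by linarith
    show ?case
    \<comment> \<open>When the first two conditions hold, the last one can fail only for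
      \<open>w\<close>, labelled before the loop: lists have no repetitions and \<open>x\<close> is
      not its own neighbour.\<close>
    proof (cases "?z \<in> closed w \<and> labels A s ?z = 0 \<and> ?z \<notin> C m")
      case True
      then have "A' (side s) ?z = 0" using I(3) by (simp add: labels_def)
      moreover have "queue_extends (r 10) (A 3) (Suc (r' 10)) ((A' 3)(r' 10 := ?z)) (C (Suc m))"
        using queue_extends_push[OF I(4), of ?z] True CSuc by simp
      moreover have "(A' (side s))(?z := Suc w) = (\<lambda>y. if y \<in> C (Suc m) then Suc w else A (side s) y)"
        using I(3) CSuc True by auto
      ultimately show ?thesis
        using True I(1,2,5,6) r' A2 k' 8(1,3,4)
        by (auto simp: assign_label_def same_except_def)
    next
      case False
      then have "C (Suc m) = C m" using CSuc by auto
      moreover have "A' 2 ?z = Suc w \<Longrightarrow> A' (side s) ?z \<noteq> 0"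
        using False A2 I(3) by (auto simp: labels_def)
      ultimately show ?thesis
        using I r' A2 k' 8(1,3,4) by (auto simp: same_except_def)
    qed
  next
    case (9 r' A' k')
    then have I: "same_except {6, 7, 8, 10, 12} r r'" "same_except {side s, 3} A A'"
      "A' (side s) = (\<lambda>y. if y \<in> C (deg x) then Suc w else A (side s) y)"
      "queue_extends (r 10) (A 3) (r' 10) (A' 3) (C (deg x))"
      "k \<le> k' + 11 + 10 * deg x" "1 \<le> k'" by auto
    show ?case
      using I Cdeg labels_relabelI[OF I(3)[unfolded Cdeg] I(2)] by (auto intro!: Q)
  qed (use k in auto)
  moreover have "k - Suc (Suc (Suc (Suc (Suc (Suc (Suc 0)))))) = k - 7" by simp
  ultimately show ?thesis
    using False r k by (simp add: assign_class_def assign_label_def)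
qed

lemma wp_find_outside:
  assumes r: "r 1 = 0" "r 4 = w" and w: "w < n" and k: "7 + 8 * deg w \<le> k"
    and Q: "\<And>r' k'. same_except {5, 6, 7, 8, 12, 13} r r' \<Longrightarrow>
      (if r' 5 = w then \<forall>u\<in>N w. labels A s u \<noteq> 0 \<or> labels A (\<not> s) u = labels A (\<not> s) w
       else r' 5 \<in> N w \<and> labels A s (r' 5) = 0 \<and> labels A (\<not> s) (r' 5) \<noteq> labels A (\<not> s) w) \<Longrightarrow>
      k \<le> k' + 7 + 8 * deg w \<Longrightarrow> Q r' A k'"
  shows "wp xs (find_outside s) Q r A k"
proof -
  let ?P = "\<lambda>u. labels A s u \<noteq> 0 \<or> labels A (\<not> s) u = labels A (\<not> s) w"
  let ?Inv = "\<lambda>m r' A' k'. same_except {5, 6, 7, 8, 12, 13} r r' \<and> A' = A \<and>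
      r' 13 = labels A (\<not> s) w \<and>
      (if r' 5 = w then \<forall>u\<in>set (take m (al ! w)). ?P u else r' 5 \<in> N w \<and> \<not> ?P (r' 5)) \<and>
      k \<le> k' + 6 + 8 * m \<and> 1 + 8 * deg w \<le> k' + 8 * m"
  let ?r = "r(5 := w, 13 := labels A (\<not> s) w)"
  have "wp xs (for_neighbours 4 6 7 8
       (Get 12 (side s) 8 ;;
        IfNeq 12 1 Skip (Get 12 (side (\<not> s)) 8 ;; IfNeq 12 13 (Copy 5 8) Skip))) Q ?r A (k - 2)"
  proof (rule wp_for_neighbours[where w = w and Inv = ?Inv], goal_cases)
    case (8 m r' A' k')
    let ?z = "al ! w ! m"
    have z: "?z \<in> N w" "?z \<noteq> w" using 8(1) w al_irrefl by (auto, metis nth_mem)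
    have "r' 1 = 0" using 8(2) r(1) by (auto simp: same_except_def)
    then show ?case
      using 8 z take_Suc_nth[OF 8(1)] by (auto simp: same_except_def labels_def)
  next
    case (9 r' A' k')
    then show ?case using Q[of r' "k' - 1"] by (auto split: if_splits)
  qed (use r w k in \<open>auto simp: same_except_def\<close>)
  then show ?thesis using r k unfolding find_outside_def by (simp add: numeral_2_eq_2 labels_def)
qed

text \<open>\<open>u\<close> lies in \<open>closed w\<close> but not in \<open>N u\<close>, so the
  count is at most \<open>deg w\<close>, and this value means that \<open>u\<close> is adjacent to
  everything else in \<open>closed w\<close>.\<close>

lemma card_closed_neighbours:
  assumes "w < n" "u \<in> N w"
  shows "card {z \<in> N u. z \<in> closed w} = deg w \<longleftrightarrow> closed w \<subseteq> closed u"
proof -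
  have u: "u < n" "u \<notin> N u" "w \<notin> N w" "u \<noteq> w" using assms al_less al_irrefl by auto
  have sub: "{z \<in> N u. z \<in> closed w} \<subseteq> closed w - {u}" using u by auto
  have "card (closed w - {u}) = deg w"
    using assms u distinct_card[OF distinct_al[OF assms(1)]] by (simp add: closed_def)
  moreover have "finite (closed w - {u})" by (simp add: closed_def)
  ultimately have "card {z \<in> N u. z \<in> closed w} = deg w \<longleftrightarrow> {z \<in> N u. z \<in> closed w} = closed w - {u}"
    using card_subset_eq[OF _ sub] by metis
  also have "\<dots> \<longleftrightarrow> closed w \<subseteq> closed u" using u by (auto simp: closed_def)
  finally show ?thesis .
qed

text \<open>\<open>S\<close> collects the neighbours whose lists are read. All of them, except
  possibly the final choice, dominate \<open>w\<close>; hence they are adjacent to the final choice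
  and lie in the new class. The premise provides credits for all unlabelled neighbours, but only
  those in \<open>S\<close> are charged.\<close>

lemma wp_find_non_dominating:
  assumes r: "r 1 = 0" "r 4 = w" "r 11 = Suc w" and w: "w < n"
    and marks: "\<And>y. y < n \<Longrightarrow> A 2 y = Suc w \<longleftrightarrow> y \<in> closed w"
    and k: "7 + 6 * deg w + (\<Sum>u | u \<in> N w \<and> labels A False u = 0. 16 + 6 * deg u) \<le> k"
    and Q: "\<And>r' k' S. same_except {5, 6, 7, 8, 12, 14, 15, 16, 17, 18} r r' \<Longrightarrow>
      (if r' 5 = w then \<forall>u\<in>N w. labels A False u \<noteq> 0
       else r' 5 \<in> N w \<and> labels A False (r' 5) = 0 \<and>
         (closed w \<subseteq> closed (r' 5) \<longrightarrow>
           (\<forall>u\<in>N w. labels A False u = 0 \<longrightarrow> closed w \<subseteq> closed u))) \<Longrightarrow>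
      S \<subseteq> new_class (labels A) False w (r' 5) \<Longrightarrow>
      k \<le> k' + 7 + 6 * deg w + (\<Sum>u\<in>S. 16 + 6 * deg u) \<Longrightarrow> Q r' A k'"
  shows "wp xs find_non_dominating Q r A k"
proof -
  let ?free = "\<lambda>u. labels A False u = 0"
  let ?c = "\<lambda>u. 16 + 6 * deg u"
  \<comment> \<open>While the flag \<open>f\<close> is 0, \<open>S\<close> consists of all
    unlabelled neighbours met so far, and all of them dominate. Afterwards \<open>S\<close> is
    frozen, with \<open>x\<close> as its only non-dominating member.\<close>
  define I where "I m x f k' S \<longleftrightarrow> S \<subseteq> {u \<in> set (take m (al ! w)). ?free u} \<and>
      k \<le> k' + 6 + 6 * m + sum ?c S \<and>
      (if f = 0 then {u \<in> set (take m (al ! w)). ?free u} \<subseteq> S \<and>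
          (\<forall>u\<in>S. closed w \<subseteq> closed u) \<and> (if S = {} then x = w else x \<in> S)
       else x \<in> S \<and> \<not> closed w \<subseteq> closed x \<and> (\<forall>u\<in>S - {x}. closed w \<subseteq> closed u))"
    for m x f k' :: nat and S
  define J where "J m x f k' \<longleftrightarrow> (\<exists>S. I m x f k' S)" for m x f k'
  let ?Inv = "\<lambda>m r' A' k'. same_except {5, 6, 7, 8, 12, 14, 15, 16, 17, 18} r r' \<and> A' = A \<and>
      J m (r' 5) (r' 18) k'"
  let ?r = "r(5 := w, 18 := 0)"
  have "wp xs (for_neighbours 4 6 7 8
       (IfNeq 18 1 Skip
         (Get 12 0 8 ;;
          IfNeq 12 1 Skip
            (Copy 5 8 ;; Inc 17 4 ;; Input 17 17 ;; count_equal 2 11 8 14 15 16 ;;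
             IfNeq 17 7 (Inc 18 1) Skip)))) Q ?r A (k - 2)"
  proof (rule wp_for_neighbours[where w = w and Inv = ?Inv], goal_cases)
    case 7
    have "J 0 w 0 (k - 6)" unfolding J_def I_def by (intro exI[of _ "{}"]) auto
    then show ?case by (simp add: same_except_def)
  next
    case (8 m r' A' k')
    let ?z = "al ! w ! m"
    have z: "?z \<in> N w" "?z < n" using 8(1) w al_less by auto
    have S1: "same_except {5, 6, 7, 8, 12, 14, 15, 16, 17, 18} r r'" "A' = A" using 8(2) by auto
    have r': "r' 1 = 0" "r' 4 = w" "r' 11 = Suc w" using same_exceptD[OF S1(1)] r by auto
    obtain S where "I m (r' 5) (r' 18) k' S" using 8(2) unfolding J_def by blast
    note S = this[unfolded I_def]
    have tk: "{u \<in> set (take (Suc m) (al ! w)). ?free u} =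
        (if ?free ?z then insert ?z {u \<in> set (take m (al ! w)). ?free u}
         else {u \<in> set (take m (al ! w)). ?free u})"
      using take_Suc_nth[OF 8(1)] by auto
    have finS: "finite S" using S by (auto intro: finite_subset)
    have zS: "?z \<notin> S" using S nth_notin_take[OF w 8(1)] by auto
    have SN: "S \<subseteq> {u. u \<in> N w \<and> ?free u}" using S by (auto dest: in_set_takeD)
    have fin: "finite {u. u \<in> N w \<and> ?free u}" by simp
    have "sum ?c S \<le> (\<Sum>u | u \<in> N w \<and> ?free u. ?c u)" by (rule sum_mono2[OF fin SN]) simp
    then have k0: "7 + 6 * (deg w - m) \<le> k' + 6" using k S 8(1) by linarith
    have k1: "?free ?z \<Longrightarrow> 17 + 6 * deg ?z + 6 * (deg w - m) \<le> k'"
    proof -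
      assume "?free ?z"
      then have "sum ?c (insert ?z S) \<le> (\<Sum>u | u \<in> N w \<and> ?free u. ?c u)"
        using SN z by (intro sum_mono2[OF fin]) auto
      then have "?c ?z + sum ?c S \<le> (\<Sum>u | u \<in> N w \<and> ?free u. ?c u)" using zS finS by simp
      then show ?thesis using k S 8(1) by linarith
    qed
    have k2: "7 \<le> k'" using k0 8(1) by simp
    show ?case
    proof (cases "r' 18 = 0 \<and> ?free ?z")
      case False
      have J: "J (Suc m) (r' 5) (r' 18) k''" if "k' \<le> k'' + 6" for k''
        using S False that k2 tk unfolding J_def I_def by (intro exI[of _ S]) auto
      show ?thesis
      proof (cases "r' 18 = 0")
        case True
        then have "A 0 ?z \<noteq> 0" using False by (simp add: labels_def side_def)
        with True show ?thesis using S1 r' k2 8(3,4) J[of "k' - 6"] by (simp add: same_except_def)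
      next
        case F: False
        then show ?thesis using S1 r' k2 8(3,4) J[of "k' - 4"] by (simp add: same_except_def)
      qed
    next
      case True
      then have A0: "A 0 ?z = 0" by (simp add: labels_def side_def)
      note k1 = k1[OF conjunct2[OF True]]
      let ?r1 = "r'(8 := ?z, 6 := Suc (start w + m), 12 := 0, 5 := ?z, 17 := start w)"
      have sw: "xs ! Suc w = start w" "Suc w < length xs"
        using w encoding_start[of w] length_encoding by auto
      have sumI: "sum ?c (insert ?z S) = ?c ?z + sum ?c S" using zS finS by simp
      have "wp xs (count_equal 2 11 8 14 15 16) (wp xs (IfNeq 17 7 (Inc 18 1) Skip)
          (\<lambda>r' A' k'. r' 6 = Suc (start w + m) \<and> r' 7 = start w + deg w \<and> ?Inv (Suc m) r' A' k'))
          ?r1 A (k' - 9)"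
      proof (rule wp_count_equal[where w = ?z], goal_cases)
        case 1 show ?case by simp
      next
        case 2 show ?case using z by simp
      next
        case 3 show ?case by simp
      next
        case 4 show ?case using k1 by simp
      next
        case (5 r2 k2)
        have "{u \<in> N ?z. A 2 u = ?r1 11} = {u \<in> N ?z. u \<in> closed w}"
          using marks al_less[OF z(2)] r' by auto
        then have "r2 17 = start w + card {u \<in> N ?z. u \<in> closed w}" using 5(2) by simp
        then have r17: "r2 17 = start w + deg w \<longleftrightarrow> closed w \<subseteq> closed ?z"
          using card_closed_neighbours[OF w z(1)] by simp
        have r2: "r2 6 = Suc (start w + m)" "r2 7 = start w + deg w" "r2 18 = 0" "r2 5 = ?z" "r2 1 = 0"
          using same_exceptD[OF 5(1)] 8(3,4) True r' by auto
        have s2: "same_except {5, 6, 7, 8, 12, 14, 15, 16, 17, 18} r r2"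
          using S1(1) 5(1) by (auto simp: same_except_def)
        have k3: "k' \<le> k2 + 14 + 6 * deg ?z" using 5(3) by simp
        then have k4: "3 \<le> k2" using k1 8(1) by simp
        show ?case
        proof (cases "closed w \<subseteq> closed ?z")
          case dom: True
          have "J (Suc m) ?z 0 (k2 - 1)"
            using S True dom tk sumI k3 k4 unfolding J_def I_def
            by (intro exI[of _ "insert ?z S"]) auto
          then show ?thesis using dom r17 r2 s2 k4 by auto
        next
          case dom: False
          have "J (Suc m) ?z 1 (k2 - 2)"
            using S True dom tk sumI k3 k4 zS unfolding J_def I_def
            by (intro exI[of _ "insert ?z S"]) auto
          then show ?thesis using dom r17 r2 s2 k4
            by (auto simp: same_except_def numeral_2_eq_2)
        qed
      qed
      then show ?thesis using True A0 r' k1 sw S1(2)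
        by (simp add: numeral_eq_Suc)
    qed
  next
    case (9 r' A' k')
    then have S1: "same_except {5, 6, 7, 8, 12, 14, 15, 16, 17, 18} r r'" "A' = A" by auto
    obtain S where "I (deg w) (r' 5) (r' 18) k' S" using 9 unfolding J_def by blast
    note S = this[unfolded I_def]
    have SN: "S \<subseteq> {u. u \<in> N w \<and> ?free u}" using S by auto
    have "sum ?c S \<le> (\<Sum>u | u \<in> N w \<and> ?free u. ?c u)" by (rule sum_mono2[OF _ SN]) auto
    then have k': "1 \<le> k'" using k S by linarith
    have "Q r' A (k' - 1)"
    proof (rule Q[OF S1(1)])
      show "k \<le> k' - 1 + 7 + 6 * deg w + (\<Sum>u\<in>S. 16 + 6 * deg u)" using S k' by simp
      show "S \<subseteq> new_class (labels A) False w (r' 5)"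
      proof (cases "S = {}")
        case False
        then have x: "r' 5 \<in> S" using S by (auto split: if_splits)
        have "u \<in> N (r' 5)" if "u \<in> S" "u \<noteq> r' 5" for u
        proof -
          have "closed w \<subseteq> closed u" "r' 5 \<in> N w" "u < n"
            using S that SN x al_less w by (auto split: if_splits)
          then have "r' 5 \<in> N u" using that(2) by (auto simp: closed_def)
          then show ?thesis using al_sym \<open>u < n\<close> by blast
        qed
        moreover have "r' 5 \<noteq> w" using x SN al_irrefl w by auto
        ultimately show ?thesis using SN by (auto simp: new_class_def)
      qed simp
      show "if r' 5 = w then \<forall>u\<in>N w. labels A False u \<noteq> 0
       else r' 5 \<in> N w \<and> labels A False (r' 5) = 0 \<and>
         (closed w \<subseteq> closed (r' 5) \<longrightarrow>
           (\<forall>u\<in>N w. labels A False u = 0 \<longrightarrow> closed w \<subseteq> closed u))"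
      proof (cases "r' 18 = 0")
        case True
        have "w \<notin> S" using SN al_irrefl w by auto
        then show ?thesis using True S SN by (auto split: if_splits)
      next
        case False
        then have "r' 5 \<in> S" "\<not> closed w \<subseteq> closed (r' 5)" using S by auto
        then show ?thesis using SN al_irrefl w by auto
      qed
    qed
    then show ?case using k' S1(2) by simp
  qed (use r w k in auto)
  then show ?thesis using r k unfolding find_non_dominating_def by (simp add: numeral_2_eq_2)
qed

end


subsection \<open>Labelling all vertices\<close>

definition process :: "bool \<Rightarrow> com" where
  "process s = Get 12 (side s) 4 ;; IfNeq 12 1 Skip (mark ;; find_outside s ;; assign_class s)"

definition seed :: com where
  "seed = Get 12 0 3 ;;
     IfNeq 12 1 Skip (Copy 4 3 ;; mark ;; find_non_dominating ;; assign_class False)"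

definition propagate :: com where
  "propagate = WhileNeq 9 10 (Get 4 3 9 ;; Inc 9 9 ;; process False ;; process True)"

definition label_all :: com where
  "label_all = for_vertices (seed ;; propagate)"

context adjacency_graph
begin

section \<open>Amortised accounting\<close>

text \<open>Labelling \<open>y\<close> on side \<open>s\<close> releases \<open>Suc (deg y)\<close>,
  the scale of one reading of its list; the \<open>Suc\<close> covers fixed costs and the queue
  entry.\<close>

definition unlabelled_weight :: "(bool \<Rightarrow> nat \<Rightarrow> nat) \<Rightarrow> bool \<Rightarrow> nat" where
  "unlabelled_weight L s = (\<Sum>y | y < n \<and> L s y = 0. Suc (deg y))"

definition potential :: "(bool \<Rightarrow> nat \<Rightarrow> nat) \<Rightarrow> nat" where
  "potential L = unlabelled_weight L False + unlabelled_weight L True"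

lemma potential_alt: "potential L = unlabelled_weight L s + unlabelled_weight L (\<not> s)"
  by (cases s) (simp_all add: potential_def)

definition extendable :: "(bool \<Rightarrow> nat \<Rightarrow> nat) \<Rightarrow> bool \<Rightarrow> nat \<Rightarrow> nat \<Rightarrow> bool" where
  "extendable L s w x \<longleftrightarrow> w < n \<and> L s w = 0 \<and> (x \<noteq> w \<longrightarrow> x \<in> N w \<and> L s x = 0)"

lemma new_class_subset:
  assumes "extendable L s w x"
  shows "new_class L s w x \<subseteq> {y. y < n \<and> L s y = 0}" "w \<in> new_class L s w x" "x \<in> new_class L s w x"
    "x < n"
  using assms al_less by (auto simp: extendable_def new_class_def split: if_splits)

lemma potential_relabel:
  assumes "extendable L s w x"
  shows "potential (relabel L s w x) + (\<Sum>y\<in>new_class L s w x. Suc (deg y)) = potential L"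
proof -
  let ?C = "new_class L s w x" and ?U = "{y. y < n \<and> L s y = 0}"
  have "{y. y < n \<and> relabel L s w x s y = 0} = ?U - ?C"
    by (auto simp: relabel_def)
  then have "unlabelled_weight (relabel L s w x) s = (\<Sum>y\<in>?U - ?C. Suc (deg y))"
    unfolding unlabelled_weight_def by (simp only:)
  then have "unlabelled_weight (relabel L s w x) s + (\<Sum>y\<in>?C. Suc (deg y)) = unlabelled_weight L s"
    using sum.subset_diff[OF new_class_subset(1)[OF assms], of "\<lambda>y. Suc (deg y)"]
    by (simp add: unlabelled_weight_def)
  moreover have "unlabelled_weight (relabel L s w x) (\<not> s) = unlabelled_weight L (\<not> s)"
    by (simp add: unlabelled_weight_def relabel_def)
  ultimately show ?thesis by (simp add: potential_alt[where s = s])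
qed

lemma sum_le_potential:
  assumes "S \<subseteq> {y. y < n \<and> L s y = 0}"
  shows "(\<Sum>y\<in>S. Suc (deg y)) \<le> potential L"
proof -
  have "(\<Sum>y\<in>S. Suc (deg y)) \<le> unlabelled_weight L s"
    unfolding unlabelled_weight_def by (rule sum_mono2[OF _ assms]) auto
  then show ?thesis by (simp add: potential_alt[where s = s])
qed

lemma deg_le_potential:
  assumes "y < n" "L s y = 0"
  shows "Suc (deg y) \<le> potential L"
  using sum_le_potential[of "{y}" L s] assms by simp

text \<open>The weight released by a class dominates separately the scans of \<open>w\<close>, the
  scan of \<open>x\<close> and the number of queue entries.\<close>

lemma new_class_weight:
  assumes "extendable L s w x"
  shows "Suc (deg w) \<le> (\<Sum>y\<in>new_class L s w x. Suc (deg y))"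
    "Suc (deg x) \<le> (\<Sum>y\<in>new_class L s w x. Suc (deg y))"
    "card (new_class L s w x) \<le> (\<Sum>y\<in>new_class L s w x. Suc (deg y))"
proof -
  note S = new_class_subset[OF assms]
  have fin: "finite (new_class L s w x)" by (rule finite_subset[OF S(1)]) simp
  show "Suc (deg w) \<le> (\<Sum>y\<in>new_class L s w x. Suc (deg y))"
    "Suc (deg x) \<le> (\<Sum>y\<in>new_class L s w x. Suc (deg y))"
    using member_le_sum[OF S(2) _ fin, of "\<lambda>y. Suc (deg y)"]
      member_le_sum[OF S(3) _ fin, of "\<lambda>y. Suc (deg y)"] by simp_all
  show "card (new_class L s w x) \<le> (\<Sum>y\<in>new_class L s w x. Suc (deg y))"
    using sum_mono[of "new_class L s w x" "\<lambda>_. 1" "\<lambda>y. Suc (deg y)"] by simp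
qed

text \<open>The set \<open>X\<close> contains a vertex that has left the queue but is not yet fully labelled.\<close>

definition invariant :: "nat set \<Rightarrow> nat \<Rightarrow> nat \<Rightarrow> (bool \<Rightarrow> nat \<Rightarrow> nat) \<Rightarrow>
    (nat \<Rightarrow> nat) \<Rightarrow> (nat \<Rightarrow> nat) \<Rightarrow> bool" where
  "invariant X h t L M q \<longleftrightarrow> fresh L \<and> (\<forall>y w. M y = Suc w \<longrightarrow> w < n \<and> y \<in> closed w) \<and>
     h \<le> t \<and> (\<forall>i<t. q i < n \<and> (\<exists>s. L s (q i) \<noteq> 0)) \<and>
     (\<forall>y<n. \<forall>s. y \<notin> X \<longrightarrow> L s y \<noteq> 0 \<longrightarrow> L (\<not> s) y = 0 \<longrightarrow> y \<in> q ` {h..<t}) \<and>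
     (Ex labelling \<longrightarrow> feasible L)"

lemma invariant_pending:
  "invariant X h t L M q \<Longrightarrow> y < n \<Longrightarrow> y \<notin> X \<Longrightarrow> L s y \<noteq> 0 \<Longrightarrow> L (\<not> s) y = 0 \<Longrightarrow> y \<in> q ` {h..<t}"
  unfolding invariant_def by blast

definition labels_grow :: "(bool \<Rightarrow> nat \<Rightarrow> nat) \<Rightarrow> (bool \<Rightarrow> nat \<Rightarrow> nat) \<Rightarrow> bool" where
  "labels_grow L L' \<longleftrightarrow> (\<forall>s y. L s y \<noteq> 0 \<longrightarrow> L' s y \<noteq> 0)"

lemma labels_grow_relabel: "labels_grow L (relabel L s w x)"
  by (simp add: labels_grow_def relabel_def)

text \<open>Feasibility is left as a premise because it is the only part that seeding and
  propagation justify differently.\<close>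

lemma invariant_relabel:
  assumes "invariant X h t L M q" "extendable L s w x"
    and "queue_extends t q t' q' (new_class L s w x)"
    and "Ex labelling \<Longrightarrow> feasible L \<Longrightarrow> fresh L \<Longrightarrow> feasible (relabel L s w x)"
  shows "invariant X h t' (relabel L s w x) M q'"
proof -
  let ?L = "relabel L s w x"
  have w: "w < n" "L s w = 0" using assms(2) by (auto simp: extendable_def)
  have q: "t \<le> t'" "\<And>i. i < t \<Longrightarrow> q' i = q i" "q' ` {t..<t'} = new_class L s w x"
    using assms(3) unfolding queue_extends_def same_except_def by auto
  have I: "fresh L" "\<And>y w. M y = Suc w \<Longrightarrow> w < n \<and> y \<in> closed w" "h \<le> t"
    "\<And>i. i < t \<Longrightarrow> q i < n \<and> (\<exists>s. L s (q i) \<noteq> 0)"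
    "\<And>y s. y < n \<Longrightarrow> y \<notin> X \<Longrightarrow> L s y \<noteq> 0 \<Longrightarrow> L (\<not> s) y = 0 \<Longrightarrow> y \<in> q ` {h..<t}"
    "Ex labelling \<Longrightarrow> feasible L"
    using assms(1) unfolding invariant_def by blast+
  have "q' i < n \<and> (\<exists>s. ?L s (q' i) \<noteq> 0)" if "i < t'" for i
  proof (cases "i < t")
    case True
    then show ?thesis using I(4)[OF True] q(2) labels_grow_relabel[of L s w x]
      unfolding labels_grow_def by metis
  next
    case False
    then have "q' i \<in> new_class L s w x" using q(3) that by (metis atLeastLessThan_iff imageI not_less)
    then show ?thesis using new_class_subset(1)[OF assms(2)] by (auto simp: relabel_def)
  qed
  moreover have "y \<in> q' ` {h..<t'}" if y: "y < n" "y \<notin> X" "?L s' y \<noteq> 0" "?L (\<not> s') y = 0" for y s'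
  proof (cases "y \<in> new_class L s w x")
    case True
    then have "y \<in> q' ` {t..<t'}" using q(3) by simp
    then show ?thesis using I(3) by auto
  next
    case False
    then have "?L s'' y = L s'' y" for s'' by (simp add: relabel_def)
    then have "y \<in> q ` {h..<t}" using I(5) y by simp
    then obtain i where "i \<in> {h..<t}" "y = q' i" using q(2) by auto
    then show ?thesis using q(1) by auto
  qed
  ultimately show ?thesis
    using I(1-3,6) q(1) assms(4) fresh_relabel[OF I(1) w] unfolding invariant_def by auto
qed

text \<open>Marks are never cleared: by the invariant any older entry \<open>Suc w\<close> already
  lies in \<open>closed w\<close>, so marking makes the set exact.\<close>

lemma marks_after_mark:
  assumes "invariant X h t L M q" "w < n"
    and "M' = (\<lambda>y. if y = w \<or> y \<in> N w then Suc w else M y)"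
  shows "M' y = Suc w \<longleftrightarrow> y \<in> closed w" "invariant X h t L M' q"
  using assms unfolding invariant_def by (auto simp: closed_def)

lemma invariant_discharge:
  assumes "invariant {w} h t L M q" "\<And>s. L s w \<noteq> 0"
  shows "invariant {} h t L M q"
proof -
  have "y \<noteq> w" if "L (\<not> s) y = 0" for y s using assms(2)[of "\<not> s"] that by blast
  then show ?thesis using assms(1) unfolding invariant_def by blast
qed

text \<open>Of the credits, \<open>100 * potential\<close> pays for future labels, \<open>7 * (r 10 - r 9)\<close> for removing the
  vertices in the queue, and \<open>R\<close> is left to the continuation.\<close>

lemma wp_process:
  assumes r: "r 1 = 0" "r 4 = w" and w: "w < n" "labels A s w \<noteq> 0 \<or> labels A (\<not> s) w \<noteq> 0"
    and I: "invariant X (r 9) (r 10) (labels A) (A 2) (A 3)"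
    and k: "100 * potential (labels A) + 7 * (r 10 - r 9) + R + 2 \<le> k"
    and Q: "\<And>r' A' k'. same_except {5, 6, 7, 8, 10, 11, 12, 13} r r' \<Longrightarrow>
      same_except {0, 1, 2, 3} A A' \<Longrightarrow>
      invariant X (r 9) (r' 10) (labels A') (A' 2) (A' 3) \<Longrightarrow>
      labels_grow (labels A) (labels A') \<Longrightarrow> labels A' s w \<noteq> 0 \<Longrightarrow>
      100 * potential (labels A') + 7 * (r' 10 - r 9) + R \<le> k' \<Longrightarrow> Q r' A' k'"
  shows "wp xs (process s) Q r A k"
proof (cases "labels A s w = 0")
  case False
  have "Q (r(12 := A (side s) w)) A (k - 2)"
    by (rule Q) (use False I k in \<open>auto simp: same_except_def labels_grow_def\<close>)
  then show ?thesis using False r k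
    by (simp add: process_def labels_def numeral_2_eq_2)
next
  case True
  let ?r = "r(12 := 0)"
  note dw = deg_le_potential[of w "labels A" s, OF w(1) True]
  have "wp xs mark (wp xs (find_outside s ;; assign_class s) Q) ?r A (k - 2)"
  proof (rule wp_mark[where w = w], goal_cases)
    case 1 show ?case using r by simp
  next
    case 2 show ?case by (rule w)
  next
    case 3 show ?case using k dw by simp
  next
    case (4 r1 A1 k1)
    have A1: "labels A1 = labels A" "A1 3 = A 3"
      using 4(3) by (auto simp: labels_def side_def same_except_def fun_eq_iff)
    note m = marks_after_mark[OF I w(1) 4(4)]
    have r1: "r1 1 = 0" "r1 4 = w" "r1 9 = r 9" "r1 10 = r 10"
      using 4(1) r by (auto simp: same_except_def)
    show ?case unfolding wp_simps
    proof (rule wp_find_outside[where w = w], goal_cases)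
      case 1 show ?case by (rule r1)
    next
      case 2 show ?case by (rule r1)
    next
      case 3 show ?case by (rule w)
    next
      case 4 show ?case using k dw \<open>k - 2 \<le> k1 + 7 + 4 * deg w\<close> by simp
    next
      case (5 r2 k2)
      let ?x = "r2 5"
      have ext: "extendable (labels A) s w ?x"
        using 5(2) w(1) True A1 by (auto simp: extendable_def split: if_splits)
      have x: "?x < n" "labels A s ?x = 0"
        using new_class_subset[OF ext] by auto
      note dx = deg_le_potential[OF x(1), of "labels A", OF x(2)]
      have r2: "r2 1 = 0" "r2 4 = w" "r2 11 = Suc w" "r2 9 = r 9" "r2 10 = r 10"
        using 5(1) r1 4(2) by (auto simp: same_except_def)
      show ?case
      proof (rule wp_assign_class[where w = w and x = ?x], goal_cases)
        case 6 show ?case using True A1 by simp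
      next
        case 7 then show ?case using ext A1 by (simp add: extendable_def)
      next
        case (8 y) show ?case by (rule m)
      next
        case 9 show ?case using k dw dx 4(5) 5(3) by linarith
      next
        case (10 r3 A3 k3)
        let ?C = "new_class (labels A) s w ?x"
        let ?W = "\<Sum>y\<in>?C. Suc (deg y)"
        have L3: "labels A3 = relabel (labels A) s w ?x" using 10(3) A1 by simp
        have qe: "queue_extends (r 10) (A 3) (r3 10) (A3 3) ?C" using 10(4) A1 r2 by simp
        have A32: "A3 2 = A1 2" using 10(2) side_neq(1)[of s] by (auto simp: same_except_def)
        show ?case
        proof (rule Q)
          show "same_except {5, 6, 7, 8, 10, 11, 12, 13} r r3"
            using 4(1) 5(1) 10(1) by (auto simp: same_except_def)
          show "same_except {0, 1, 2, 3} A A3"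
            using 4(3) 10(2) by (auto simp: same_except_def side_def)
          show "invariant X (r 9) (r3 10) (labels A3) (A3 2) (A3 3)"
            unfolding L3 A32
          proof (rule invariant_relabel[OF m(2) ext qe])
            assume "feasible (labels A)" "fresh (labels A)"
            then show "feasible (relabel (labels A) s w ?x)"
              using feasible_propagate[of "labels A" w s ?x, OF _ _ w(1) True] w(2) True 5(2) A1
              by (simp split: if_splits)
          qed
          show "labels_grow (labels A) (labels A3)" unfolding L3 by (rule labels_grow_relabel)
          show "labels A3 s w \<noteq> 0" unfolding L3 by (simp add: relabel_def new_class_def)
          have "r3 10 = r 10 + card ?C" using qe by (simp add: queue_extends_def)
          moreover have "r 9 \<le> r 10" using I by (simp add: invariant_def)
          ultimately show "100 * potential (labels A3) + 7 * (r3 10 - r 9) + R \<le> k3"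
            using k 4(5) 5(3) 10(5) new_class_weight[OF ext] potential_relabel[OF ext]
            unfolding L3 by linarith
        qed
      qed (use r2 w in auto)
    qed
  qed
  then show ?thesis using True r k
    by (simp add: process_def labels_def numeral_2_eq_2)
qed

lemma invariant_saturated:
  assumes "invariant {} h h L M q"
  shows "saturated L"
proof -
  have "\<not> (L s y \<noteq> 0 \<and> L (\<not> s) y = 0)" if "y < n" for s y
    using invariant_pending[OF assms that, of s] by auto
  from this[of _ False] this[of _ True] show ?thesis unfolding saturated_def by force
qed

text \<open>The seed runs only on an empty queue; there the invariant gives
  \<open>saturated\<close>, which \<open>feasible_seed\<close> requires.\<close>

lemma wp_seed:
  assumes r: "r 1 = 0" "r 3 = v" "r 9 = r 10" and v: "v < n"
    and I: "invariant {} (r 9) (r 10) (labels A) (A 2) (A 3)"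
    and k: "100 * potential (labels A) + R + 3 \<le> k"
    and Q: "\<And>r' A' k'. same_except ({4..18} - {9}) r r' \<Longrightarrow>
      same_except {0, 1, 2, 3} A A' \<Longrightarrow>
      invariant {} (r 9) (r' 10) (labels A') (A' 2) (A' 3) \<Longrightarrow>
      labels_grow (labels A) (labels A') \<Longrightarrow> labels A' False v \<noteq> 0 \<Longrightarrow>
      100 * potential (labels A') + 7 * (r' 10 - r 9) + R \<le> k' \<Longrightarrow> Q r' A' k'"
  shows "wp xs seed Q r A k"
proof (cases "labels A False v = 0")
  case False
  have "Q (r(12 := A 0 v)) A (k - 2)"
    by (rule Q) (use False I k r in \<open>auto simp: same_except_def labels_grow_def\<close>)
  then show ?thesis using False r k
    by (simp add: seed_def labels_def side_def numeral_2_eq_2)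
next
  case True
  let ?r = "r(12 := 0, 4 := v)"
  note dv = deg_le_potential[of v "labels A" False, OF v True]
  have sat: "saturated (labels A)" using I r(3) by (auto intro: invariant_saturated)
  let ?F = "{u. u \<in> N v \<and> labels A False u = 0}"
  \<comment> \<open>This shows only that enough credits are present before the search; actual
    spending is bounded through \<open>S\<close> below.\<close>
  have "(\<Sum>u\<in>?F. Suc (deg u)) \<le> potential (labels A)"
    by (rule sum_le_potential[where s = False]) (use al_less v in auto)
  moreover have "(\<Sum>u\<in>?F. 16 + 6 * deg u) \<le> (\<Sum>u\<in>?F. 16 * Suc (deg u))"
    by (intro sum_mono) simp
  ultimately have F: "(\<Sum>u\<in>?F. 16 + 6 * deg u) \<le> 16 * potential (labels A)"
    unfolding sum_distrib_left[symmetric] by linarith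
  have "wp xs mark (wp xs (find_non_dominating ;; assign_class False) Q) ?r A (k - 3)"
  proof (rule wp_mark[where w = v], goal_cases)
    case 1 show ?case using r by simp
  next
    case 2 show ?case by (rule v)
  next
    case 3 show ?case using k dv by simp
  next
    case (4 r1 A1 k1)
    have A1: "labels A1 = labels A" "A1 3 = A 3"
      using 4(3) by (auto simp: labels_def side_def same_except_def fun_eq_iff)
    note m = marks_after_mark[OF I v 4(4)]
    have r1: "r1 1 = 0" "r1 4 = v" "r1 9 = r 9" "r1 10 = r 10"
      using 4(1) r by (auto simp: same_except_def)
    show ?case unfolding wp_simps
    proof (rule wp_find_non_dominating[where w = v], goal_cases)
      case (5 y) show ?case by (rule m)
    next
      case 6
      show ?case using k dv 4(5) F unfolding A1 by linarith
    next
      case (7 r2 k2 S)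
      let ?x = "r2 5"
      have ext: "extendable (labels A) False v ?x"
        using 7(2) v True A1 by (auto simp: extendable_def split: if_splits)
      have x: "?x < n" "labels A False ?x = 0"
        using new_class_subset[OF ext] by auto
      note dx = deg_le_potential[OF x(1), of "labels A", OF x(2)]
      let ?C = "new_class (labels A) False v ?x"
      let ?W = "\<Sum>y\<in>?C. Suc (deg y)"
      have "finite ?C" by (rule finite_subset[OF new_class_subset(1)[OF ext]]) simp
      then have "(\<Sum>u\<in>S. Suc (deg u)) \<le> ?W" using 7(3) A1 by (intro sum_mono2) auto
      moreover have "(\<Sum>u\<in>S. 16 + 6 * deg u) \<le> (\<Sum>u\<in>S. 16 * Suc (deg u))"
        by (intro sum_mono) simp
      ultimately have S: "(\<Sum>u\<in>S. 16 + 6 * deg u) \<le> 16 * ?W"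
        unfolding sum_distrib_left[symmetric] by linarith
      note W = new_class_weight[OF ext] potential_relabel[OF ext]
      have r2: "r2 1 = 0" "r2 4 = v" "r2 11 = Suc v" "r2 9 = r 9" "r2 10 = r 10"
        using 7(1) r1 4(2) by (auto simp: same_except_def)
      show ?case
      proof (rule wp_assign_class[where w = v and x = ?x], goal_cases)
        case 6 show ?case using True A1 by simp
      next
        case 7 then show ?case using ext A1 by (simp add: extendable_def)
      next
        case (8 y) show ?case by (rule m)
      next
        case 9 show ?case using k W 4(5) 7(4) S by linarith
      next
        case (10 r3 A3 k3)
        have L3: "labels A3 = relabel (labels A) False v ?x" using 10(3) A1 by simp
        have qe: "queue_extends (r 10) (A 3) (r3 10) (A3 3) ?C" using 10(4) A1 r2 by simp
        have A32: "A3 2 = A1 2" using 10(2) by (auto simp: same_except_def side_def)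
        show ?case
        proof (rule Q)
          show "same_except ({4..18} - {9}) r r3"
            using 4(1) 7(1) 10(1) by (auto simp: same_except_def)
          show "same_except {0, 1, 2, 3} A A3"
            using 4(3) 10(2) by (auto simp: same_except_def side_def)
          show "invariant {} (r 9) (r3 10) (labels A3) (A3 2) (A3 3)"
            unfolding L3 A32
          proof (rule invariant_relabel[OF m(2) ext qe])
            assume "feasible (labels A)" "fresh (labels A)"
            then show "feasible (relabel (labels A) False v ?x)"
              using feasible_seed[of "labels A" v ?x, OF _ _ sat v True] 7(2) A1
              by (simp add: closed_def split: if_splits)
          qed
          show "labels_grow (labels A) (labels A3)" unfolding L3 by (rule labels_grow_relabel)
          show "labels A3 False v \<noteq> 0" unfolding L3 by (simp add: relabel_def new_class_def)
          \<comment> \<open>Besides the 3 opening credits, the expenses are at most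
            \<open>49 * ?W\<close>: 14 for marking and scanning \<open>v\<close>, 16 for the tests,
            12 for assigning, 7 for the queue. The factor 100 leaves slack.\<close>
          have "r3 10 = r 10 + card ?C" using qe by (simp add: queue_extends_def)
          then show "100 * potential (labels A3) + 7 * (r3 10 - r 9) + R \<le> k3"
            using k 4(5) 7(4) S 10(5) W r(3) unfolding L3 by linarith
        qed
      qed (use r2 v in auto)
    qed (use r1 v 4(2) in auto)
  qed
  moreover have "k - Suc (Suc (Suc 0)) = k - 3" by simp
  ultimately show ?thesis using True r k
    by (simp add: seed_def labels_def side_def)
qed

lemma wp_propagate:
  assumes r: "r 1 = 0"
    and I: "invariant {} (r 9) (r 10) (labels A) (A 2) (A 3)"
    and k: "100 * potential (labels A) + 7 * (r 10 - r 9) + R + 1 \<le> k"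
    and Q: "\<And>r' A' k'. same_except {4..18} r r' \<Longrightarrow> same_except {0, 1, 2, 3} A A' \<Longrightarrow>
      invariant {} (r' 9) (r' 10) (labels A') (A' 2) (A' 3) \<Longrightarrow> r' 9 = r' 10 \<Longrightarrow>
      labels_grow (labels A) (labels A') \<Longrightarrow>
      100 * potential (labels A') + R \<le> k' \<Longrightarrow> Q r' A' k'"
  shows "wp xs propagate Q r A k"
proof -
  let ?I = "\<lambda>r' A' k'. same_except {4..18} r r' \<and> same_except {0, 1, 2, 3} A A' \<and>
      invariant {} (r' 9) (r' 10) (labels A') (A' 2) (A' 3) \<and>
      labels_grow (labels A) (labels A') \<and>
      100 * potential (labels A') + 7 * (r' 10 - r' 9) + R + 1 \<le> k'"
  show ?thesis unfolding propagate_def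
  proof (rule wp_WhileNeq[where I = ?I])
    show "?I r A k" using I k by (simp add: same_except_def labels_grow_def)
  next
    fix r0 A0 k0
    assume I0: "?I r0 A0 k0" and ne: "r0 9 \<noteq> r0 10"
    let ?w = "A0 3 (r0 9)" and ?h = "Suc (r0 9)" and ?t = "r0 10"
    have inv0: "invariant {} (r0 9) ?t (labels A0) (A0 2) (A0 3)" using I0 by simp
    have lt: "r0 9 < ?t" using inv0 ne by (simp add: invariant_def)
    have w: "?w < n" "\<exists>s. labels A0 s ?w \<noteq> 0" using inv0 lt by (auto simp: invariant_def)
    have inv1: "invariant {?w} ?h ?t (labels A0) (A0 2) (A0 3)"
    proof -
      have "{r0 9..<?t} = insert (r0 9) {?h..<?t}" using lt by auto
      then show ?thesis using inv0 lt unfolding invariant_def by auto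
    qed
    let ?r = "r0(4 := ?w, 9 := ?h)"
    have r0: "r0 1 = 0" using I0 r by (auto simp: same_except_def)
    \<comment> \<open>The 7 credits of the removed entry split into 3 for the loop test,
      \<open>Get\<close> and \<open>Inc\<close>, and 2 for the opening test of each
      \<open>process\<close>; the first call hands on the 2 of the second inside its
      \<open>R\<close>.\<close>
    have k0: "100 * potential (labels A0) + 7 * (?t - ?h) + (R + 1 + 2) + 2 + 3 \<le> k0"
      using I0 lt by linarith
    have "wp xs (process False) (wp xs (process True) ?I) ?r A0 (k0 - 3)"
    proof (rule wp_process[where w = ?w and R = "R + 1 + 2" and X = "{?w}"], goal_cases)
      case (7 r1 A1 k1)
      have r1: "r1 1 = 0" "r1 4 = ?w" "r1 9 = ?h" using 7(1) r0 by (auto simp: same_except_def)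
      show ?case
      proof (rule wp_process[where w = ?w and R = "R + 1" and X = "{?w}"], goal_cases)
        case (7 r2 A2 k2)
        have r2: "r2 9 = ?h" using 7(1) r1 by (auto simp: same_except_def)
        have "labels A2 s ?w \<noteq> 0" for s
          using 7(4,5) \<open>labels A1 False ?w \<noteq> 0\<close> by (cases s) (auto simp: labels_grow_def)
        then have "invariant {} ?h (r2 10) (labels A2) (A2 2) (A2 3)"
          using invariant_discharge 7(3) r1(3) by simp
        moreover have "labels_grow (labels A) (labels A2)"
          using I0 7(4) \<open>labels_grow (labels A0) (labels A1)\<close> by (auto simp: labels_grow_def)
        moreover have "same_except {4..18} r r2"
          using I0 7(1) \<open>same_except {5, 6, 7, 8, 10, 11, 12, 13} ?r r1\<close>
          by (auto simp: same_except_def)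
        moreover have "same_except {0, 1, 2, 3} A A2"
          using I0 7(2) \<open>same_except {0, 1, 2, 3} A0 A1\<close> by (auto simp: same_except_def)
        ultimately show ?case using 7(6) r1(3) r2 by simp
      qed (use 7 r1 w in auto)
    qed (use r0 w inv1 k0 in \<open>auto simp: ex_bool_eq\<close>)
    moreover have "k0 - Suc (Suc (Suc 0)) = k0 - 3" by simp
    ultimately show "0 < k0 \<and> wp xs (Get 4 3 9 ;; Inc 9 9 ;; process False ;; process True) ?I r0 A0 (k0 - 1)"
      using k0 by simp
  next
    fix r0 A0 k0
    assume I0: "?I r0 A0 k0" and eq: "r0 9 = r0 10"
    then show "0 < k0 \<and> Q r0 A0 (k0 - 1)" by (auto intro!: Q)
  qed
qed

text \<open>The loop itself ensures labels only on side \<open>False\<close>; since the queue is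
  empty at the end, saturation supplies side \<open>True\<close>.\<close>

lemma wp_label_all:
  assumes r: "r 1 = 0" "r 2 = n" "r 9 = 0" "r 10 = 0"
    and A: "\<And>j y. j < 3 \<Longrightarrow> A j y = 0"
    and k: "100 * potential (labels A) + 10 * n + R + 2 \<le> k"
    and Q: "\<And>r' A' k'. same_except {3..18} r r' \<Longrightarrow> same_except {0, 1, 2, 3} A A' \<Longrightarrow>
      (\<And>s y. y < n \<Longrightarrow> labels A' s y \<noteq> 0) \<Longrightarrow> (Ex labelling \<longrightarrow> feasible (labels A')) \<Longrightarrow>
      R \<le> k' \<Longrightarrow> Q r' A' k'"
  shows "wp xs label_all Q r A k"
proof -
  let ?Inv = "\<lambda>v r' A' k'. same_except {3..18} r r' \<and> same_except {0, 1, 2, 3} A A' \<and>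
      r' 9 = r' 10 \<and> invariant {} (r' 9) (r' 10) (labels A') (A' 2) (A' 3) \<and>
      (\<forall>y<v. labels A' False y \<noteq> 0) \<and>
      100 * potential (labels A') + 10 * n + R + 1 \<le> k' + 10 * v"
  have L0: "labels A s y = 0" for s y using A by (simp add: labels_def side_def)
  show ?thesis unfolding label_all_def
  proof (rule wp_for_vertices[where Inv = ?Inv], goal_cases)
    case 1 show ?case by (rule r)
  next
    case 2 show ?case using k by simp
  next
    case 3
    have "invariant {} 0 0 (labels A) (A 2) (A 3)"
      using L0 A feasible_initial by (auto simp: invariant_def fresh_def)
    then show ?case using r k by (auto simp: same_except_def)
  next
    case (4 v r0 A0 k0)
    have inv0: "invariant {} (r0 9) (r0 10) (labels A0) (A0 2) (A0 3)" "r0 9 = r0 10"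
      and s0: "same_except {3..18} r r0" "same_except {0, 1, 2, 3} A A0"
      and l0: "\<forall>y<v. labels A0 False y \<noteq> 0"
      and k0: "100 * potential (labels A0) + 10 * n + R + 1 \<le> k0 + 10 * v" using 4(4) by auto
    have r0: "r0 1 = 0" using s0 r by (auto simp: same_except_def)
    \<comment> \<open>Ten credits per vertex cover the loop test, the fixed costs of
      \<open>seed\<close> and \<open>propagate\<close>, and the increment; part of the summand 5 is
      slack.\<close>
    let ?R = "10 * (n - Suc v) + R + 5"
    have k1: "100 * potential (labels A0) + (?R + 1) + 3 \<le> k0 - 1" "1 \<le> k0"
      using k0 4(1) by linarith+
    have "wp xs seed (wp xs propagate (\<lambda>r' A' k'. r' 3 = v \<and> r' 2 = n \<and> 1 \<le> k' \<and>
        ?Inv (Suc v) (r'(3 := Suc v)) A' (k' - 1))) r0 A0 (k0 - 1)"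
    proof (rule wp_seed[OF r0 4(2) inv0(2) 4(1) inv0(1) k1(1)], goal_cases)
      case (1 r1 A1 k1)
      have r1: "r1 1 = 0" "r1 9 = r0 9" "r1 3 = v" "r1 2 = n"
        using 1(1) r0 4(2,3) by (auto simp: same_except_def)
      show ?case
      proof (rule wp_propagate[where R = ?R], goal_cases)
        case (4 r2 A2 k2)
        have "r2 3 = v" "r2 2 = n" using 4(1) r1 by (auto simp: same_except_def)
        moreover have "labels A2 False y \<noteq> 0" if "y < Suc v" for y
          using that l0 1(4,5) 4(5) by (auto simp: less_Suc_eq labels_grow_def)
        moreover have "same_except {3..18} r (r2(3 := Suc v))"
          using s0 1(1) 4(1) by (auto simp: same_except_def)
        moreover have "same_except {0, 1, 2, 3} A A2"
          using s0 1(2) 4(2) by (auto simp: same_except_def)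
        ultimately show ?case using 4(3,4,6) \<open>v < n\<close> by auto
      qed (use 1 r1 in auto)
    qed
    then show ?case using k1(2) by simp
  next
    case (5 r0 A0 k0)
    then have "saturated (labels A0)" using invariant_saturated by metis
    then have "labels A0 s y \<noteq> 0" if "y < n" for s y
      using 5 that by (cases s) (auto simp: saturated_def)
    then show ?case using 5 by (auto simp: invariant_def intro!: Q)
  qed
qed

end


subsection \<open>Checking the labels\<close>

lemma side_neq_count [simp]: "side s \<noteq> 4 + side s'" "4 + side s' \<noteq> side s"
  by (simp_all add: side_def)

definition count_labels :: "bool \<Rightarrow> com" where
  "count_labels s = for_vertices
     (Get 12 (side s) 3 ;; Get 13 (4 + side s) 12 ;; Inc 13 13 ;; Put (4 + side s) 12 13)"

definition check_cliques :: "bool \<Rightarrow> com" where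
  "check_cliques s = for_vertices
     (Get 13 (side s) 3 ;; Zero 17 ;; count_equal (side s) 13 3 6 7 8 ;;
      Inc 17 17 ;; Get 12 (4 + side s) 13 ;; IfNeq 17 12 (Zero 0) Skip)"

definition check_edges :: com where
  "check_edges = for_vertices
     (for_neighbours 3 6 7 8
       (Get 12 0 8 ;; Get 13 0 3 ;;
        IfNeq 12 13 (Get 12 1 8 ;; Get 13 1 3 ;; IfNeq 12 13 (Zero 0) Skip) Skip))"

definition decide_labelling :: com where
  "decide_labelling =
     Input 2 1 ;; label_all ;; Inc 0 1 ;; count_labels False ;; count_labels True ;;
     check_cliques False ;; check_cliques True ;; check_edges"

context adjacency_graph
begin

lemma wp_count_labels:
  assumes r: "r 2 = n" and A: "A (4 + side s) = (\<lambda>_. 0)" and k: "2 + 6 * n \<le> k"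
    and Q: "\<And>r' A' k'. same_except {3, 12, 13} r r' \<Longrightarrow> same_except {4 + side s} A A' \<Longrightarrow>
      A' (4 + side s) = (\<lambda>l. card {y. y < n \<and> A (side s) y = l}) \<Longrightarrow>
      k \<le> k' + 2 + 6 * n \<Longrightarrow> Q r' A' k'"
  shows "wp xs (count_labels s) Q r A k"
proof -
  let ?Inv = "\<lambda>v r' A' k'. same_except {3, 12, 13} r r' \<and> same_except {4 + side s} A A' \<and>
      A' (4 + side s) = (\<lambda>l. card {y. y < v \<and> A (side s) y = l}) \<and>
      k \<le> k' + 1 + 6 * v \<and> 1 + 6 * n \<le> k' + 6 * v"
  show ?thesis unfolding count_labels_def
  proof (rule wp_for_vertices[where Inv = ?Inv], goal_cases)
    case (4 v r' A' k')
    have S: "{y. y < Suc v \<and> A (side s) y = l} =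
        (if A (side s) v = l then insert v {y. y < v \<and> A (side s) y = l}
         else {y. y < v \<and> A (side s) y = l})" for l
      by (auto simp: less_Suc_eq)
    have "card {y. y < Suc v \<and> A (side s) y = l} =
        (if A (side s) v = l then Suc (card {y. y < v \<and> A (side s) y = l})
         else card {y. y < v \<and> A (side s) y = l})" for l
      unfolding S by simp
    moreover have "A' (side s) = A (side s)" using 4(4) by (simp add: same_except_def)
    ultimately show ?case using 4 by (auto simp: same_except_def fun_eq_iff)
  next
    case (5 r' A' k')
    then show ?case using Q[of r' A' "k' - 1"] by auto
  qed (use r A k in \<open>auto simp: same_except_def\<close>)
qed

lemma wp_check_cliques:
  assumes r: "r 2 = n" and k: "2 + 13 * n + 6 * (\<Sum>v<n. deg v) \<le> k"
    and Q: "\<And>r' k'. same_except {0, 3, 6, 7, 8, 12, 13, 17} r r' \<Longrightarrow>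
      r' 0 = (if \<forall>v<n. Suc (card {y \<in> N v. A (side s) y = A (side s) v}) = A (4 + side s) (A (side s) v)
        then r 0 else 0) \<Longrightarrow>
      k \<le> k' + 2 + 13 * n + 6 * (\<Sum>v<n. deg v) \<Longrightarrow> Q r' A k'"
  shows "wp xs (check_cliques s) Q r A k"
proof -
  let ?P = "\<lambda>v. Suc (card {y \<in> N v. A (side s) y = A (side s) v}) = A (4 + side s) (A (side s) v)"
  let ?D = "\<lambda>v. 13 * v + 6 * (\<Sum>v<v. deg v)"
  let ?Inv = "\<lambda>v r' A' k'. same_except {0, 3, 6, 7, 8, 12, 13, 17} r r' \<and> A' = A \<and>
      r' 0 = (if \<forall>u<v. ?P u then r 0 else 0) \<and> k \<le> k' + 1 + ?D v \<and> 1 + ?D n \<le> k' + ?D v"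
  show ?thesis unfolding check_cliques_def
  proof (rule wp_for_vertices[where Inv = ?Inv], goal_cases)
    case (4 v r0 A0 k0)
    have A0: "A0 = A" using 4(4) by simp
    have "?D (Suc v) \<le> ?D n"
      using 4(1) sum_mono2[of "{..<n}" "{..<Suc v}" deg] by auto
    then have k0: "13 + 6 * deg v + 1 \<le> k0" using 4(4) by simp
    have Pv: "(\<forall>u<Suc v. ?P u) \<longleftrightarrow> ?P v \<and> (\<forall>u<v. ?P u)" by (auto simp: less_Suc_eq)
    have "wp xs (count_equal (side s) 13 3 6 7 8)
        (wp xs (Inc 17 17 ;; Get 12 (4 + side s) 13 ;; IfNeq 17 12 (Zero 0) Skip)
          (\<lambda>r' A' k'. r' 3 = v \<and> r' 2 = n \<and> 1 \<le> k' \<and> ?Inv (Suc v) (r'(3 := Suc v)) A' (k' - 1)))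
        (r0(13 := A (side s) v, 17 := 0)) A (k0 - 3)"
    proof (rule wp_count_equal[where w = v], goal_cases)
      case (5 r1 k1)
      have r1: "r1 17 = card {z \<in> N v. A (side s) z = A (side s) v}" "r1 13 = A (side s) v"
        "r1 3 = v" "r1 2 = n" "r1 0 = r0 0"
        using 5(1,2) 4(2,3) by (auto simp: same_except_def)
      have s1: "same_except {0, 3, 6, 7, 8, 12, 13, 17} r r1"
        using 4(4) 5(1) by (auto simp: same_except_def)
      show ?case
      proof (cases "?P v")
        case True
        then show ?thesis using 4(4) 5(3) k0 r1 s1 unfolding Pv
          by (auto simp: same_except_def)
      next
        case False
        then show ?thesis using 4(4) 5(3) k0 r1 s1 unfolding Pv
          by (auto simp: same_except_def)
      qed
    qed (use 4(1,2) k0 in auto)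
    moreover have "k0 - Suc (Suc (Suc 0)) = k0 - 3" by simp
    ultimately show ?case using k0 4(2) by (simp add: A0)
  next
    case (5 r' A' k')
    then show ?case using Q[of r' "k' - 1"] by auto
  qed (use r k in \<open>auto simp: same_except_def\<close>)
qed

lemma wp_check_vertex_edges:
  assumes r: "r 3 = v" and v: "v < n" and k: "5 + 10 * deg v \<le> k"
    and Q: "\<And>r' k'. same_except {0, 6, 7, 8, 12, 13} r r' \<Longrightarrow>
      r' 0 = (if \<forall>y\<in>N v. \<exists>s. labels A s y = labels A s v then r 0 else 0) \<Longrightarrow>
      k \<le> k' + 5 + 10 * deg v \<Longrightarrow> Q r' A k'"
  shows "wp xs (for_neighbours 3 6 7 8
       (Get 12 0 8 ;; Get 13 0 3 ;;
        IfNeq 12 13 (Get 12 1 8 ;; Get 13 1 3 ;; IfNeq 12 13 (Zero 0) Skip) Skip)) Q r A k"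
proof -
  let ?P = "\<lambda>y. A 0 y = A 0 v \<or> A 1 y = A 1 v"
  have P: "(\<exists>s. labels A s y = labels A s v) \<longleftrightarrow> ?P y" for y
    by (auto simp: ex_bool_eq labels_def side_def)
  let ?Inv = "\<lambda>m r' A' k'. same_except {0, 6, 7, 8, 12, 13} r r' \<and> A' = A \<and>
      r' 0 = (if \<forall>y\<in>set (take m (al ! v)). ?P y then r 0 else 0) \<and>
      k \<le> k' + 4 + 10 * m \<and> 1 + 10 * deg v \<le> k' + 10 * m"
  show ?thesis
  proof (rule wp_for_neighbours[where w = v and Inv = ?Inv], goal_cases)
    case (8 m r' A' k')
    have "r' 3 = v" using 8(2) r by (simp add: same_except_def)
    then show ?case using 8
      by (auto simp: same_except_def take_Suc_nth split: if_splits)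
  next
    case (9 r' A' k')
    then show ?case using Q[of r' "k' - 1"] by (auto simp: P)
  qed (use r v k in \<open>auto simp: same_except_def\<close>)
qed

lemma wp_check_edges:
  assumes r: "r 2 = n" and k: "2 + 7 * n + 10 * (\<Sum>v<n. deg v) \<le> k"
    and Q: "\<And>r' k'.
      r' 0 = (if \<forall>v<n. \<forall>y\<in>N v. \<exists>s. labels A s y = labels A s v then r 0 else 0) \<Longrightarrow> Q r' A k'"
  shows "wp xs check_edges Q r A k"
proof -
  let ?P = "\<lambda>v. \<forall>y\<in>N v. \<exists>s. labels A s y = labels A s v"
  let ?D = "\<lambda>v. 7 * v + 10 * (\<Sum>v<v. deg v)"
  let ?Inv = "\<lambda>v r' A' k'. A' = A \<and>
      r' 0 = (if \<forall>u<v. ?P u then r 0 else 0) \<and> 1 + ?D n \<le> k' + ?D v"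
  show ?thesis unfolding check_edges_def
  proof (rule wp_for_vertices[where Inv = ?Inv], goal_cases)
    case (4 v r0 A0 k0)
    have A0: "A0 = A" using 4(4) by simp
    have "?D (Suc v) \<le> ?D n"
      using 4(1) sum_mono2[of "{..<n}" "{..<Suc v}" deg] by auto
    then have k0: "7 + 10 * deg v + 1 \<le> k0" using 4(4) by simp
    have Pv: "(\<forall>u<Suc v. ?P u) \<longleftrightarrow> ?P v \<and> (\<forall>u<v. ?P u)" by (auto simp: less_Suc_eq)
    note outer = 4
    have "wp xs (for_neighbours 3 6 7 8
       (Get 12 0 8 ;; Get 13 0 3 ;;
        IfNeq 12 13 (Get 12 1 8 ;; Get 13 1 3 ;; IfNeq 12 13 (Zero 0) Skip) Skip))
      (\<lambda>r' A' k'. r' 3 = v \<and> r' 2 = n \<and> 1 \<le> k' \<and>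
        ?Inv (Suc v) (r'(3 := Suc v)) A' (k' - 1)) r0 A (k0 - 1)"
    proof (rule wp_check_vertex_edges[where v = v], goal_cases)
      case (4 r1 k1)
      have r1: "r1 3 = v" "r1 2 = n" using 4(1) outer(2,3) by (auto simp: same_except_def)
      have "r1 0 = (if \<forall>u<Suc v. ?P u then r 0 else 0)"
        unfolding Pv using 4(2) outer(4) by auto
      moreover have "k0 \<le> k1 + 6 + 10 * deg v" using 4(3) by linarith
      ultimately show ?case using r1 outer(4) k0 by auto
    qed (use 4(1,2) k0 in auto)
    then show ?case using k0 A0 by simp
  next
    case (5 r' A' k')
    then show ?case using Q[of r' "k' - 1"] by auto
  qed (use r k in auto)
qed

lemma sum_deg: "(\<Sum>v<n. deg v) = length (concat al)"
  by (simp add: length_concat sum_list_sum_nth atLeast0LessThan)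

lemma potential_initial: "potential (\<lambda>_ _. 0) = 2 * (n + length (concat al))"
proof -
  have "unlabelled_weight (\<lambda>_ _. 0) s = (\<Sum>y<n. Suc (deg y))" for s
    by (simp add: unlabelled_weight_def lessThan_def)
  then show ?thesis by (simp add: potential_def sum_Suc sum_deg)
qed

text \<open>Both sides start with weight \<open>n + length (concat al)\<close>, so the potential
  claims 200 of the 300 credits per unit; the rest covers the vertex loop and the checks.\<close>

lemma wp_decide_labelling:
  "wp xs decide_labelling (\<lambda>r A k. r 0 = (if Ex labelling then 1 else 0))
     (\<lambda>_. 0) (\<lambda>_ _. 0) (300 * (n + length (concat al) + 1))"
proof -
  let ?Q = "\<lambda>r A k. r 0 = (if Ex labelling then 1 else (0 :: nat))"
  let ?D = "length (concat al)"
  let ?A = "\<lambda>_ _. 0 :: nat" and ?r = "(\<lambda>_. 0)(2 := n) :: nat \<Rightarrow> nat"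
  \<comment> \<open>Exactly what follows \<open>label_all\<close>: one \<open>Inc\<close>, two runs
    each of \<open>count_labels\<close> and \<open>check_cliques\<close>, and
    \<open>check_edges\<close>.\<close>
  let ?R = "11 + 45 * n + 22 * ?D"
  have L0: "labels ?A = (\<lambda>_ _. 0)" by (simp add: labels_def fun_eq_iff)
  have "wp xs label_all (wp xs (Inc 0 1 ;; count_labels False ;; count_labels True ;;
     check_cliques False ;; check_cliques True ;; check_edges) ?Q) ?r ?A
     (300 * (n + ?D + 1) - 1)"
  proof (rule wp_label_all[where R = ?R], goal_cases)
    case 6
    show ?case unfolding L0 potential_initial by simp
  next
    case (7 r1 A1 k1)
    let ?r1 = "r1(0 := Suc (r1 1))"
    have r1: "r1 1 = 0" "r1 2 = n" using 7(1) by (auto simp: same_except_def)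
    have A1: "A1 4 = (\<lambda>_. 0)" "A1 5 = (\<lambda>_. 0)" using 7(2) by (auto simp: same_except_def)
    have "wp xs (count_labels False) (wp xs (count_labels True ;;
       check_cliques False ;; check_cliques True ;; check_edges) ?Q) ?r1 A1 (k1 - 1)"
    proof (rule wp_count_labels, goal_cases)
      case (4 r2 A2 k2)
      have r2: "r2 0 = 1" "r2 2 = n" using 4(1) r1 by (auto simp: same_except_def)
      show ?case unfolding wp_simps
      proof (rule wp_count_labels, goal_cases)
        case 1 show ?case by (rule r2)
      next
        case 2 show ?case using 4(2) A1 by (simp add: same_except_def side_def)
      next
        case 3 show ?case using 4(4) 7(5) by simp
      next
        case (4 r3 A3 k3)
        have r3: "r3 0 = 1" "r3 2 = n" using 4(1) r2 by (auto simp: same_except_def)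
        have L3: "A3 (side s) = labels A1 s" for s
          using 4(2) \<open>same_except {4 + side False} A1 A2\<close> by (simp add: same_except_def labels_def)
        have "A2 (side True) = A1 (side True)"
          using \<open>same_except {4 + side False} A1 A2\<close> by (simp add: same_except_def)
        then have C3: "A3 (4 + side s) l = card {y. y < n \<and> labels A1 s y = l}" for s l
          using 4(2,3) \<open>A2 (4 + side False) = _\<close>
          by (cases s) (simp_all add: same_except_def side_def labels_def)
        have k3: "12 * n + 4 + k3 \<ge> k1 - 1" using 4(4) \<open>k1 - 1 \<le> k2 + 2 + 6 * n\<close> by simp
        let ?c = "\<lambda>s. \<forall>v<n. Suc (card {y \<in> N v. labels A1 s y = labels A1 s v}) =
          card {y. y < n \<and> labels A1 s y = labels A1 s v}"
        show ?case unfolding wp_simps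
        proof (rule wp_check_cliques, goal_cases)
          case 1 show ?case by (rule r3)
        next
          case 2 show ?case using k3 7(5) by (simp add: sum_deg)
        next
          case (3 r4 k4)
          have r4: "r4 0 = (if ?c False then 1 else 0)" "r4 2 = n"
            using 3(1,2) r3 unfolding L3 C3 by (auto simp: same_except_def)
          show ?case unfolding wp_simps
          proof (rule wp_check_cliques, goal_cases)
            case 1 show ?case by (rule r4)
          next
            case 2 show ?case using k3 7(5) \<open>k3 \<le> k4 + _ + _ + _\<close> by (simp add: sum_deg)
          next
            case (3 r5 k5)
            have r5: "r5 0 = (if ?c False \<and> ?c True then 1 else 0)" "r5 2 = n"
              using 3(1,2) r4 unfolding L3 C3 by (auto simp: same_except_def)
            show ?case
            proof (rule wp_check_edges, goal_cases)
              case 1 show ?case by (rule r5)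
            next
              case 2
              show ?case using k3 7(5) \<open>k3 \<le> k4 + _ + _ + _\<close> \<open>k4 \<le> k5 + _ + _ + _\<close>
                by (simp add: sum_deg)
            next
              case (3 r6 k6)
              have VE: "verified (labels A1) \<longleftrightarrow> Ex labelling"
                using verified_iff 7(3,4) by blast
              have VC: "verified (labels A1) \<longleftrightarrow> (?c False \<and> ?c True) \<and>
                  (\<forall>v<n. \<forall>y\<in>N v. \<exists>s. labels A1 s y = labels A1 s v)"
                unfolding verified_def all_bool_eq by (rule iffI; elim conjE; intro conjI; assumption)
              have L: "labels A3 = labels A1" using L3 by (simp add: labels_def fun_eq_iff)
              have aux: "x = (if e then y else 0) \<Longrightarrow> y = (if c then 1 else 0) \<Longrightarrow> (b \<longleftrightarrow> c \<and> e) \<Longrightarrow>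
                  x = (if b then 1 else 0)" for x y :: nat and b c e
                by simp
              show ?case by (rule aux[OF 3[unfolded L] r5(1) trans[OF VE[symmetric] VC]])
            qed
          qed
        qed
      qed
    qed (use r1 A1 7(5) in \<open>auto simp: side_def\<close>)
    then show ?case using 7(5) by simp
  qed auto
  then show ?thesis
    unfolding decide_labelling_def by (simp add: length_encoding encoding_0)
qed

lemma encoding_bounded: "a \<in> set xs \<Longrightarrow> a \<le> length xs"
proof -
  assume "a \<in> set xs"
  then consider "a = n" | v where "v \<le> n" "a = start v" | v where "v < n" "a \<in> N v"
    by (auto simp: encoding in_set_conv_nth[of _ al] less_Suc_eq_le simp del: upt_Suc)
  then show "a \<le> length xs"
  proof cases
    case 3
    then have "a < n" using al_less by blast
    then show ?thesis by (simp add: length_encoding)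
  qed (use start_le in \<open>auto simp: length_encoding\<close>)
qed

end

lemma well_formed_decide_labelling: "well_formed decide_labelling"
  by (simp add: decide_labelling_def label_all_def seed_def propagate_def process_def mark_def
      find_outside_def assign_class_def assign_label_def find_non_dominating_def count_labels_def
      check_cliques_def check_edges_def for_vertices_def for_neighbours_def count_equal_def side_def)

section \<open>The complete machine program\<close>

text \<open>Cell \<open>n + 1\<close> holds the end of the last list, which is the length of the
  whole input. Loading \<open>n\<close> from cell 0 and then this cell gives the base address of the
  arrays.\<close>

definition set_base :: "instr list" where
  "set_base = [Const 20 0, Load 22 20, Const 21 1, Add 22 22 21, Load 22 22]"

definition tessellability_program :: program where
  "tessellability_program = set_base @ compile 5 decide_labelling"

context adjacency_graph
begin

lemma run_tessellability_program:
  defines "K \<equiv> 300 * (n + length (concat al) + 1)"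
  shows "\<exists>t\<le>5 + 8 * K. halted tessellability_program (run tessellability_program xs t) \<and>
    reg (run tessellability_program xs t) 0 = (if Ex labelling then 1 else 0) \<and>
    (\<forall>s\<le>t. words_bounded (8 * (K + length xs) + length xs + 8) (run tessellability_program xs s))"
proof -
  \<comment> \<open>Input words are at most \<open>length xs\<close>, so this cap leaves room for
    \<open>K\<close> increments above any of them.\<close>
  let ?P = tessellability_program and ?M = "K + length xs"
  let ?W = "8 * ?M + length xs + 8"
  let ?s0 = "initial_config xs"
  let ?s1 = "run_block set_base ?s0"
  have len: "length xs = n + 2 + length (concat al)" by (rule length_encoding)
  have xsn: "xs ! Suc n = length xs" "xs ! 0 = n"
    using encoding_start[of n] encoding_0 by (simp_all add: start_def len)

  have "xs ! a \<le> ?W" if "a < length xs" for a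
    using encoding_bounded[OF nth_mem[OF that]] by linarith
  then have wb0: "words_bounded ?W ?s0"
    by (simp add: words_bounded_def initial_config_def)
  have m0: "mem ?s0 0 = n" "mem ?s0 (Suc n) = length xs" "reg ?s0 = (\<lambda>_. 0)"
    using xsn len by (simp_all add: initial_config_def)
  have "code_at ?P (pc ?s0) set_base"
    by (simp add: code_at_def tessellability_program_def nth_append initial_config_def)
  moreover have "block_bounded ?W set_base ?s0"
    using m0 len by (simp add: set_base_def)
  moreover have "length set_base = 5" by (simp add: set_base_def)
  ultimately have 1: "reaches ?P ?W 5 ?s0 ?s1" "words_bounded ?W ?s1"
    using reaches_block[of ?P ?s0 set_base ?W] wb0 by (simp_all only: simp_thms)
  have rep: "represents xs ?M (\<lambda>_. 0) (\<lambda>_ _. 0) K ?s1"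
  proof -
    have "reg ?s1 22 = length xs" "\<forall>x<20. reg ?s1 x = 0"
      using m0 by (simp_all add: set_base_def)
    moreover have "mem ?s1 = layout xs (\<lambda>_ _. 0)"
      by (simp add: set_base_def layout_def initial_config_def fun_eq_iff)
    ultimately show ?thesis
      using 1(2) encoding_bounded unfolding represents_def by simp
  qed
  have code: "code_at ?P 5 (compile 5 decide_labelling)"
    by (auto simp: code_at_def tessellability_program_def set_base_def nth_append)
  obtain r A k where big: "big xs decide_labelling (\<lambda>_. 0) (\<lambda>_ _. 0) K r A k"
    "r 0 = (if Ex labelling then 1 else 0)"
    using wp_decide_labelling unfolding wp_def K_def by blast
  have "pc ?s1 = 5" by (simp add: set_base_def initial_config_def)
  from simulation[OF big(1) well_formed_decide_labelling code rep this]
  obtain t s2 where 2: "reaches ?P ?W t ?s1 s2" "pc s2 = 5 + code_length decide_labelling"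
    "represents xs ?M r A k s2" "t + 8 * k \<le> 8 * K" by blast
  have 3: "reaches ?P ?W (5 + t) ?s0 s2" by (rule reaches_trans[OF 1(1) 2(1)])
  then have "run ?P xs (5 + t) = s2" "\<forall>s\<le>5 + t. words_bounded ?W (run ?P xs s)"
    unfolding run_def reaches_def by simp_all
  moreover have "halted ?P s2"
    using 2(2) by (simp add: halted_def tessellability_program_def set_base_def)
  moreover have "reg s2 0 = (if Ex labelling then 1 else 0)"
    using 2(3) big(2) by (simp add: represents_def)
  ultimately show ?thesis using 2(4) by (intro exI[of _ "5 + t"]) simp
qed

end

subsection \<open>Tessellations and labellings\<close>

locale graph_representation =
  fixes V :: "'a set" and E vs al
  assumes graph: "simple_graph V E" and lists: "adjacency_lists V E vs al"
begin

lemma length_vs: "length vs = length al" and distinct_vs: "distinct vs" and set_vs: "set vs = V"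
  using lists by (simp_all add: adjacency_lists_def)

lemma set_al: "i < length al \<Longrightarrow> set (al ! i) = {j. j < length al \<and> {vs ! i, vs ! j} \<in> E}"
  using lists by (simp add: adjacency_lists_def)

sublocale adjacency_graph al
proof
  show "distinct (al ! v)" if "v < length al" for v
    using lists that by (simp add: adjacency_lists_def)
  show "v \<in> set (al ! u)" if "v < length al" "u \<in> set (al ! v)" for u v
    using that set_al by (auto simp: insert_commute)
  show "v \<notin> set (al ! v)" if "v < length al" for v
    using that set_al graph by (force simp: simple_graph_def)
qed (use set_al in auto)

lemma edge_iff: "i < n \<Longrightarrow> j < n \<Longrightarrow> j \<in> N i \<longleftrightarrow> {vs ! i, vs ! j} \<in> E"
  using set_al by simp

lemma vs_eq_iff: "i < n \<Longrightarrow> j < n \<Longrightarrow> vs ! i = vs ! j \<longleftrightarrow> i = j"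
  using distinct_vs length_vs by (simp add: nth_eq_iff_index_eq)

lemma obtain_index:
  assumes "v \<in> V" obtains i where "i < n" "v = vs ! i"
  using assms set_vs length_vs by (metis in_set_conv_nth)

lemma V_eq: "V = (\<lambda>i. vs ! i) ` {..<n}"
  using set_vs length_vs by (auto simp: set_conv_nth)

lemma edgeE:
  assumes "e \<in> E"
  obtains i j where "i < n" "j < n" "i \<noteq> j" "e = {vs ! i, vs ! j}" "i \<in> N j"
proof -
  from assms graph obtain u v where e: "e = {u, v}" "u \<in> V" "v \<in> V" "u \<noteq> v"
    by (auto simp: simple_graph_def card_2_iff)
  obtain i where i: "i < n" "u = vs ! i" using obtain_index e(2) by blast
  obtain j where j: "j < n" "v = vs ! j" using obtain_index e(3) by blast
  have "i \<in> N j" using edge_iff i j assms e by (simp add: insert_commute)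
  then show thesis using that i j e by blast
qed

lemma card_V: "card V = n"
  using distinct_card[OF distinct_vs] length_vs set_vs by simp

text \<open>Each edge is counted once from either end: increasing pairs and decreasing pairs both
  inject into \<open>E\<close>.\<close>

lemma total_degree_le: "length (concat al) \<le> 2 * card E"
proof -
  let ?f = "\<lambda>(i, j). {vs ! i, vs ! j}"
  let ?S = "SIGMA i:{..<n}. N i"
  have inj: "inj_on ?f {p. fst p < n \<and> snd p < n \<and> fst p < snd p}"
    "inj_on ?f {p. fst p < n \<and> snd p < n \<and> snd p < fst p}"
    using vs_eq_iff by (auto simp: inj_on_def doubleton_eq_iff)
  have "finite E"
    by (rule finite_subset[of _ "Pow V"]) (use graph in \<open>auto simp: simple_graph_def\<close>)
  moreover have "?f ` ?S \<subseteq> E"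
    using edge_iff al_less by auto
  moreover have "inj_on ?f {p \<in> ?S. fst p < snd p}" "inj_on ?f {p \<in> ?S. snd p < fst p}"
    using al_less by (auto intro: inj_on_subset[OF inj(1)] inj_on_subset[OF inj(2)])
  ultimately have "card {p \<in> ?S. fst p < snd p} \<le> card E" "card {p \<in> ?S. snd p < fst p} \<le> card E"
    by (intro card_inj_on_le[of ?f]; blast)+
  moreover have "?S = {p \<in> ?S. fst p < snd p} \<union> {p \<in> ?S. snd p < fst p}"
    using al_irrefl by (auto simp: neq_iff) (metis nat_neq_iff)
  then have "card ?S \<le> card {p \<in> ?S. fst p < snd p} + card {p \<in> ?S. snd p < fst p}"
    by (metis (no_types, lifting) card_Un_le)
  moreover have "card ?S = (\<Sum>v<n. deg v)"
    using distinct_al by (simp add: distinct_card)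
  ultimately show ?thesis by (simp add: sum_deg)
qed

lemma labelling_imp_tessellable:
  assumes "labelling t"
  shows "tessellable 2 V E"
proof -
  define B where "B s c = {vs ! j | j. j < n \<and> t s j = c}" for s c
  define T where "T s = B s ` t s ` {..<n}" for s
  have "tessellation V E (T s)" for s
    unfolding tessellation_def
  proof (intro conjI partition_onI ballI)
    show "\<Union>(T s) = V"
      by (auto simp: T_def B_def V_eq)
    show "{} \<notin> T s" by (auto simp: T_def B_def)
    show "disjnt p q" if "p \<in> T s" "q \<in> T s" "p \<noteq> q" for p q
      using that vs_eq_iff by (auto simp: T_def B_def disjnt_def)
    show "clique V E K" if K: "K \<in> T s" for K
      unfolding clique_def
    proof (intro conjI ballI impI)
      show "K \<subseteq> V" using K by (auto simp: T_def B_def V_eq)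
      fix u v assume uv: "u \<in> K" "v \<in> K" "u \<noteq> v"
      obtain c where c: "K = B s c" using K by (auto simp: T_def)
      obtain i where i: "i < n" "u = vs ! i" "t s i = c" using uv(1) c by (auto simp: B_def)
      obtain j where j: "j < n" "v = vs ! j" "t s j = c" using uv(2) c by (auto simp: B_def)
      have "t s j = t s i" "j \<noteq> i" using i j uv(3) by auto
      then have "j \<in> N i" using assms i(1) j(1) unfolding labelling_def by blast
      then show "{u, v} \<in> E" using edge_iff i j by simp
    qed
  qed
  moreover have "\<exists>s. edge_in_tessellation e (T s)" if "e \<in> E" for e
  proof -
    obtain i j where ij: "i < n" "j < n" "e = {vs ! i, vs ! j}" "i \<in> N j"
      using edgeE \<open>e \<in> E\<close> by metis
    obtain s where "t s i = t s j" using labelling_edge[OF assms ij(2,4)] by blast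
    then have "e \<subseteq> B s (t s j)" "B s (t s j) \<in> T s" using ij by (auto simp: B_def T_def)
    then show ?thesis unfolding edge_in_tessellation_def by blast
  qed
  ultimately have "tessellation_cover V E (range T)"
    unfolding tessellation_cover_def by blast
  moreover have "card (range T) \<le> 2" using card_image_le[of UNIV T] by simp
  ultimately show ?thesis unfolding tessellable_def by (metis finite_imageI finite)
qed

text \<open>The finitely many blocks are numbered injectively; since the block of a vertex is
  unique, its number can serve as the label.\<close>

lemma tessellation_labels:
  assumes "tessellation V E T"
  obtains f :: "nat \<Rightarrow> nat"
    where "\<And>i j. i < n \<Longrightarrow> j < n \<Longrightarrow> f i = f j \<longleftrightarrow> (\<exists>K\<in>T. vs ! i \<in> K \<and> vs ! j \<in> K)"
proof -
  have P: "partition_on V T" using assms by (simp add: tessellation_def)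
  have "finite T" using finite_elements[OF _ P] graph by (simp add: simple_graph_def)
  then obtain h :: "'a set \<Rightarrow> nat" where h: "inj_on h T"
    using finite_imp_inj_to_nat_seg by blast
  have "\<exists>K. K \<in> T \<and> vs ! i \<in> K" if "i < n" for i
  proof -
    have "vs ! i \<in> V" using that set_vs length_vs by auto
    then show ?thesis using P by (auto simp: partition_on_def)
  qed
  then obtain g where g: "\<And>i. i < n \<Longrightarrow> g i \<in> T \<and> vs ! i \<in> g i" by metis
  have unique: "K = K'" if "K \<in> T" "K' \<in> T" "v \<in> K" "v \<in> K'" for K K' v
    using P that unfolding partition_on_def disjoint_def by blast
  show thesis
  proof
    fix i j assume "i < n" "j < n"
    then show "h (g i) = h (g j) \<longleftrightarrow> (\<exists>K\<in>T. vs ! i \<in> K \<and> vs ! j \<in> K)"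
      using g h unique by (metis inj_on_eq_iff)
  qed
qed

text \<open>A smaller cover is padded to a family indexed by \<open>bool\<close>: a single
  tessellation is repeated, and the empty cover is replaced by the partition into singletons twice.
  Neither creates a false adjacency, since blocks are cliques.\<close>

lemma tessellable_imp_labelling:
  assumes "tessellable 2 V E"
  shows "\<exists>t. labelling t"
proof -
  from assms obtain \<T> where \<T>: "tessellation_cover V E \<T>" "finite \<T>" "card \<T> \<le> 2"
    by (auto simp: tessellable_def)
  have single: "tessellation V E ((\<lambda>v. {v}) ` V)"
    by (auto simp: tessellation_def partition_on_def disjoint_def clique_def)
  have "\<exists>T :: bool \<Rightarrow> 'a set set. (\<forall>s. tessellation V E (T s)) \<and> \<T> \<subseteq> range T"
  proof -
    consider "card \<T> = 0" | "card \<T> = 1" | "card \<T> = 2" using \<T>(3) by linarith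
    then obtain a b where ab: "\<T> \<subseteq> {a, b}" "tessellation V E a" "tessellation V E b"
    proof cases
      case 1
      then show ?thesis using that[OF _ single single] \<T>(2) by simp
    next
      case 2
      then obtain a where "\<T> = {a}" by (auto simp: card_1_singleton_iff)
      then show ?thesis using that[of a a] \<T>(1) by (auto simp: tessellation_cover_def)
    next
      case 3
      then obtain a b where "\<T> = {a, b}" by (auto simp: card_2_iff)
      then show ?thesis using that[of a b] \<T>(1) by (auto simp: tessellation_cover_def)
    qed
    have "\<T> \<subseteq> range (\<lambda>s. if s then a else b)"
      using ab(1) by (auto simp: UNIV_bool)
    then show ?thesis using ab(2,3) by (intro exI[of _ "\<lambda>s. if s then a else b"]) simp
  qed
  then obtain T :: "bool \<Rightarrow> 'a set set" where T: "\<And>s. tessellation V E (T s)" "\<T> \<subseteq> range T" by blast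
  have "\<exists>f :: nat \<Rightarrow> nat. \<forall>i<n. \<forall>j<n. f i = f j \<longleftrightarrow> (\<exists>K\<in>T s. vs ! i \<in> K \<and> vs ! j \<in> K)" for s
    using tessellation_labels[OF T(1)] by metis
  then obtain t :: "bool \<Rightarrow> nat \<Rightarrow> nat" where
    t: "\<And>s i j. i < n \<Longrightarrow> j < n \<Longrightarrow> t s i = t s j \<longleftrightarrow> (\<exists>K\<in>T s. vs ! i \<in> K \<and> vs ! j \<in> K)"
    by metis
  have "labelling t" unfolding labelling_def
  proof (intro allI impI)
    fix i j assume ij: "i < n" "j < n" "i \<noteq> j"
    have "i \<in> N j \<longleftrightarrow> {vs ! j, vs ! i} \<in> E" using edge_iff ij by simp
    also have "\<dots> \<longleftrightarrow> (\<exists>s. \<exists>K\<in>T s. vs ! i \<in> K \<and> vs ! j \<in> K)"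
    proof
      assume "{vs ! j, vs ! i} \<in> E"
      then obtain T' where "T' \<in> \<T>" "edge_in_tessellation {vs ! j, vs ! i} T'"
        using \<T>(1) by (auto simp: tessellation_cover_def)
      moreover from this T(2) obtain s where "T' = T s" by blast
      ultimately show "\<exists>s. \<exists>K\<in>T s. vs ! i \<in> K \<and> vs ! j \<in> K"
        unfolding edge_in_tessellation_def by blast
    next
      assume "\<exists>s. \<exists>K\<in>T s. vs ! i \<in> K \<and> vs ! j \<in> K"
      then obtain s K where "K \<in> T s" "vs ! i \<in> K" "vs ! j \<in> K" by blast
      moreover have "vs ! j \<noteq> vs ! i" using vs_eq_iff ij by simp
      ultimately show "{vs ! j, vs ! i} \<in> E"
        using T(1)[of s] unfolding tessellation_def clique_def by blast
    qed
    finally show "i \<in> N j \<longleftrightarrow> (\<exists>s. t s i = t s j)" using t ij by simp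
  qed
  then show ?thesis by blast
qed

end

theorem theorem8: "solvable_in_linear_time (tessellable 2)"
  unfolding solvable_in_linear_time_def Let_def
proof (rule exI[of _ tessellability_program], rule exI[of _ 5000], rule exI[of _ 14],
    intro allI impI)
  fix V :: "nat set" and E vs al
  assume "simple_graph V E \<and> adjacency_lists V E vs al"
  then interpret graph_representation V E vs al by unfold_locales auto
  let ?P = tessellability_program
  let ?D = "length (concat al)" and ?m = "card E"
  define K where "K = 300 * (n + ?D + 1)"
  let ?W = "8 * (K + length xs) + length xs + 8"
  have t: "tessellable 2 V E \<longleftrightarrow> Ex labelling"
    using labelling_imp_tessellable tessellable_imp_labelling by blast
  have D: "?D \<le> 2 * ?m" by (rule total_degree_le)
  \<comment> \<open>Eight instructions per credit and 300 credits per unit give 2400; as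
    \<open>?D \<le> 2 * ?m\<close>, an edge counts for 4800.\<close>
  have time: "5 + 8 * K \<le> 5000 * (card V + ?m + 1)"
    using D by (simp add: K_def card_V)
  \<comment> \<open>The word bound is linear with a factor below \<open>2 ^ 13\<close>. The base is
    at least 2, so thirteen extra powers absorb the factor, hence the exponent 14.\<close>
  have "?W \<le> 2 ^ 13 * (card V + ?m + 2)"
    using D by (simp add: K_def card_V length_encoding)
  also have "\<dots> \<le> (card V + ?m + 2) ^ 13 * (card V + ?m + 2)"
    by (intro mult_right_mono power_mono) auto
  also have "\<dots> = (card V + ?m + 2) ^ 14"
    by (subst power_Suc2[symmetric]) (simp only: Suc_numeral add_num_simps)
  finally have W: "?W \<le> (card V + ?m + 2) ^ 14" .
  have mono: "words_bounded ?W s \<Longrightarrow> words_bounded ((card V + ?m + 2) ^ 14) s" for s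
    using W unfolding words_bounded_def by (meson le_trans)
  from run_tessellability_program[folded K_def] obtain u where
    "u \<le> 5 + 8 * K" "halted ?P (run ?P xs u)"
    "reg (run ?P xs u) 0 = (if Ex labelling then 1 else 0)"
    "\<forall>s\<le>u. words_bounded ?W (run ?P xs s)" by blast
  then show "\<exists>u\<le>5000 * (card V + card E + 1).
      halted ?P (run ?P xs u) \<and>
      reg (run ?P xs u) 0 = (if tessellable 2 V E then 1 else 0) \<and>
      (\<forall>s\<le>u. words_bounded ((card V + card E + 2) ^ 14) (run ?P xs s))"
    using time mono unfolding t by (intro exI[of _ u]) auto
qed

end
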